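(* Let $G$ be the group of one of Constructions B, C, D in the context, let $p^e$ be the order of $g$ (so $p^e=p$ for Constructions B and C and $p^e=9$ for Construction D), and assume $l>1$. Then the nilpotency class of $G$ lies in the interval $[2p^e,3p^e]$.
   Context: Pairs $(A,\sigma)$, $A\in\mathrm{GL}(4,q)$, $\sigma\in\mathrm{Aut}(\mathbb{F}_q)$, multiply by $(A_1,\sigma_1)\circ(A_2,\sigma_2)=(A_1^{\sigma_2}A_2,\sigma_1\sigma_2)$ ($A^\sigma$: $\sigma$ applied entrywise). $E(a,b,c,t)$ is the matrix with rows $(1,0,0,0),(-c,1,0,0),(b-ct,t,1,0),(a,b,c,1)$. Given $T,\theta$ put $\mathfrak{g}_{a,b,c}=(E(a,b,c,T(a,b,c)),\theta_{a,b,c})$. $\mathrm{tr}=\mathrm{tr}_{\mathbb{F}_q/\mathbb{F}_p}$. Construction B: $q=p^{pl}$, $p$ odd, $g(x)=x^{p^l}$; $S_1$ a reduced linearized polynomial with coefficients in $\mathbb{F}_{p^l}$; $\mu_C\in\mathbb{F}_{p^l}^*$; $\theta_{a,b,c}=g^{\mathrm{tr}(\mu_Cc)}$, $T(a,b,c)=S_1(c)$; $G=\{\mathfrak{g}_{a,b,c}:a,b,c\in\mathbb{F}_q\}$. Construction C: $q=p^{pl}$, $p$ odd, $g(x)=x^{p^l}$; $\mu_B\in\mathbb{F}_{p^l}^*$; $s_i\in\mathbb{F}_{p^l}$ ($0\le i\le pl-1$) with $\mu_Bs_i-s_{pl-i}^{p^i}\mu_B^{p^i}=0$ for $1\le i\le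 pl-1$; $S_1=\sum s_iX^{p^i}$, $Q(x)=-\mathrm{tr}(\mu_BxS_1(x))$; $\theta_{a,b,c}=g^{\frac12Q(c)+\mathrm{tr}(\mu_Bb)}$, $T(a,b,c)=S_1(c)$; $G=\{\mathfrak{g}_{a,b,c}\}$. Construction D: $p=3$, $q=3^{9l}$, $g(x)=x^{3^l}$, $g_1=g^3$; $u\in\mathbb{F}_{3^{3l}}$ with $\mu_C=u-u^g\in\mathbb{F}_{3^l}^*$; $t_C$ with $\lambda_C=\mathrm{tr}_{\mathbb{F}_q/\mathbb{F}_3}(\mu_Ct_C)\ne0$; $\mu_B\in\mathbb{F}_{3^l}^*$; $s_i\in\mathbb{F}_{3^l}$ with $-\mu_Bs_i+s_{9l-i}^{3^i}\mu_B^{3^i}=\mu_Cu^{3^i}-u\mu_C^{3^i}$, $1\le i\le 9l-1$; $\alpha\in\mathbb{F}_{3^{3l}}$, $\lambda\in\mathbb{F}_3$ with $g(\alpha)-\alpha=\lambda_Cu+\lambda\mu_C$; $S_1=\sum s_iX^{3^i}$, $Q(x)=-\mathrm{tr}_{\mathbb{F}_q/\mathbb{F}_3}(\mu_BxS_1(x))$, $K=\{z:\mathrm{tr}_{\mathbb{F}_q/\mathbb{F}_3}(\mu_Cz)=0\}$; for $a,b\in\mathbb{F}_q$, $c\in K$, $\mathfrak{g}_{a,b,c}=(E(a,b,c,S_1(c)),g_1^{\frac12Q(c)+\mathrm{tr}_{\mathbb{F}_q/\mathbb{F}_3}(\alpha c+\mu_Bb)})$; $G=\langle\{\mathfrak{g}_{a,b,c}:a,b\in\mathbb{F}_q,c\in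 K\},(E(0,0,t_C,S_1(t_C)),g)\rangle$. *)

theory Defs
  imports "HOL-Analysis.Analysis" "HOL-Algebra.Generated_Groups" "HOL-Algebra.Multiplicative_Group"
    "HOL-Computational_Algebra.Polynomial" "HOL-Computational_Algebra.Primes"
begin

definition commutator_subgroup :: "('g, 'm) monoid_scheme \<Rightarrow> 'g set \<Rightarrow> 'g set \<Rightarrow> 'g set" where
  "commutator_subgroup G H K =
     generate G {h \<otimes>\<^bsub>G\<^esub> k \<otimes>\<^bsub>G\<^esub> inv\<^bsub>G\<^esub> h \<otimes>\<^bsub>G\<^esub> inv\<^bsub>G\<^esub> k | h k. h \<in> H \<and> k \<in> K}"

text \<open>The series is indexed from 0, so that the nilpotency class is the least index at which it
  becomes trivial.\<close>

primrec lower_central_series :: "('g, 'm) monoid_scheme \<Rightarrow> nat \<Rightarrow> 'g set" where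
  "lower_central_series G 0 = carrier G"
| "lower_central_series G (Suc n) = commutator_subgroup G (lower_central_series G n) (carrier G)"

definition nilpotent_group :: "('g, 'm) monoid_scheme \<Rightarrow> bool" where
  "nilpotent_group G \<longleftrightarrow> group G \<and> (\<exists>n. lower_central_series G n = {\<one>\<^bsub>G\<^esub>})"

definition nilpotency_class :: "('g, 'm) monoid_scheme \<Rightarrow> nat" where
  "nilpotency_class G = (LEAST n. lower_central_series G n = {\<one>\<^bsub>G\<^esub>})"


definition field_auts :: "('a::field \<Rightarrow> 'a) set" where
  "field_auts = {\<sigma>. bij \<sigma> \<and> (\<forall>x y. \<sigma> (x + y) = \<sigma> x + \<sigma> y) \<and> (\<forall>x y. \<sigma> (x * y) = \<sigma> x * \<sigma> y)}"

text \<open>Automorphisms act from the right, so \<open>\<sigma>\<tau>\<close> means: first \<open>\<sigma>\<close>, then \<open>\<tau>\<close>. (For a finite field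
  the order is immaterial.)\<close>

definition Aut_field :: "('a::field \<Rightarrow> 'a) monoid" where
  "Aut_field = \<lparr>carrier = field_auts, mult = (\<lambda>\<sigma> \<tau>. \<tau> \<circ> \<sigma>), one = id\<rparr>"

type_synonym 'a semilin = "('a^4^4) \<times> ('a \<Rightarrow> 'a)"

definition GammaL4 :: "('a::field) semilin monoid" where
  "GammaL4 = \<lparr>carrier = {A. invertible A} \<times> field_auts,
     mult = (\<lambda>(A\<^sub>1, \<sigma>\<^sub>1) (A\<^sub>2, \<sigma>\<^sub>2). (map_matrix \<sigma>\<^sub>2 A\<^sub>1 ** A\<^sub>2, \<sigma>\<^sub>1 \<otimes>\<^bsub>Aut_field\<^esub> \<sigma>\<^sub>2)),
     one = (mat 1, id)\<rparr>"

definition E_mat :: "'a::field \<Rightarrow> 'a \<Rightarrow> 'a \<Rightarrow> 'a \<Rightarrow> 'a^4^4" where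
  "E_mat a b c t = vector
     [vector [1, 0, 0, 0],
      vector [- c, 1, 0, 0],
      vector [b - c * t, t, 1, 0],
      vector [a, b, c, 1]]"


text \<open>The subfield with \<open>n\<close> elements of a finite field, for \<open>n\<close> an order of a subfield.\<close>

definition subfield_of_order :: "nat \<Rightarrow> 'a::field set" where
  "subfield_of_order n = {x. x ^ n = x}"

text \<open>The trace from the field with \<open>p ^ n\<close> elements to its prime field, which is regarded as a
  subset of the big field.\<close>

definition abs_trace :: "nat \<Rightarrow> nat \<Rightarrow> 'a::field \<Rightarrow> 'a" where
  "abs_trace p n x = (\<Sum>i<n. x ^ (p ^ i))"

text \<open>\<open>f\<close> to the power \<open>x\<close>, for \<open>x\<close> in the prime field; used only for \<open>f\<close> of order the
  characteristic, so that the choice of the representative of \<open>x\<close> is immaterial.\<close>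

definition prime_field_pow :: "('a \<Rightarrow> 'a) \<Rightarrow> 'a::field \<Rightarrow> ('a \<Rightarrow> 'a)" where
  "prime_field_pow f x = f ^^ (LEAST k::nat. of_nat k = x)"

text \<open>Reduced linearized polynomials over the field with \<open>p ^ n\<close> elements.\<close>

definition lin_poly :: "nat \<Rightarrow> nat \<Rightarrow> (nat \<Rightarrow> 'a::field) \<Rightarrow> 'a poly" where
  "lin_poly p n s = (\<Sum>i<n. Polynomial.monom (s i) (p ^ i))"

definition reduced_linearized :: "nat \<Rightarrow> nat \<Rightarrow> 'a::field poly \<Rightarrow> bool" where
  "reduced_linearized p n S \<longleftrightarrow> (\<exists>s. S = lin_poly p n s)"


definition construction_B ::
  "nat \<Rightarrow> nat \<Rightarrow> ('a::{field,finite} \<Rightarrow> 'a) \<Rightarrow> 'a semilin monoid \<Rightarrow> bool" where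
  "construction_B p l g G \<longleftrightarrow>
     prime p \<and> odd p \<and> CARD('a) = p ^ (p * l) \<and> g = (\<lambda>x. x ^ (p ^ l)) \<and>
     (\<exists>S\<^sub>1 \<mu>\<^sub>C.
        reduced_linearized p (p * l) S\<^sub>1 \<and>
        (\<forall>i. Polynomial.coeff S\<^sub>1 i \<in> subfield_of_order (p ^ l)) \<and>
        \<mu>\<^sub>C \<in> subfield_of_order (p ^ l) - {0} \<and>
        G = GammaL4\<lparr>carrier :=
              {(E_mat a b c (poly S\<^sub>1 c), prime_field_pow g (abs_trace p (p * l) (\<mu>\<^sub>C * c))) | a b c. True}\<rparr>)"

definition construction_C ::
  "nat \<Rightarrow> nat \<Rightarrow> ('a::{field,finite} \<Rightarrow> 'a) \<Rightarrow> 'a semilin monoid \<Rightarrow> bool" where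
  "construction_C p l g G \<longleftrightarrow>
     prime p \<and> odd p \<and> CARD('a) = p ^ (p * l) \<and> g = (\<lambda>x. x ^ (p ^ l)) \<and>
     (\<exists>\<mu>\<^sub>B s S\<^sub>1 Q.
        \<mu>\<^sub>B \<in> subfield_of_order (p ^ l) - {0} \<and>
        (\<forall>i<p * l. s i \<in> subfield_of_order (p ^ l)) \<and>
        (\<forall>i\<in>{1..p * l - 1}. \<mu>\<^sub>B * s i - s (p * l - i) ^ (p ^ i) * \<mu>\<^sub>B ^ (p ^ i) = 0) \<and>
        S\<^sub>1 = lin_poly p (p * l) s \<and>
        Q = (\<lambda>x. - abs_trace p (p * l) (\<mu>\<^sub>B * x * poly S\<^sub>1 x)) \<and>
        G = GammaL4\<lparr>carrier :=
              {(E_mat a b c (poly S\<^sub>1 c),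
                prime_field_pow g (1 / 2 * Q c + abs_trace p (p * l) (\<mu>\<^sub>B * b))) | a b c. True}\<rparr>)"

definition construction_D ::
  "nat \<Rightarrow> ('a::{field,finite} \<Rightarrow> 'a) \<Rightarrow> 'a semilin monoid \<Rightarrow> bool" where
  "construction_D l g G \<longleftrightarrow>
     CARD('a) = 3 ^ (9 * l) \<and> g = (\<lambda>x. x ^ (3 ^ l)) \<and>
     (\<exists>u \<mu>\<^sub>C t\<^sub>C lam\<^sub>C \<mu>\<^sub>B s \<alpha> lam S\<^sub>1 Q K.
        u \<in> subfield_of_order (3 ^ (3 * l)) \<and>
        \<mu>\<^sub>C = u - g u \<and> \<mu>\<^sub>C \<in> subfield_of_order (3 ^ l) - {0} \<and>
        lam\<^sub>C = abs_trace 3 (9 * l) (\<mu>\<^sub>C * t\<^sub>C) \<and> lam\<^sub>C \<noteq> 0 \<and>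
        \<mu>\<^sub>B \<in> subfield_of_order (3 ^ l) - {0} \<and>
        (\<forall>i<9 * l. s i \<in> subfield_of_order (3 ^ l)) \<and>
        (\<forall>i\<in>{1..9 * l - 1}.
           - \<mu>\<^sub>B * s i + s (9 * l - i) ^ (3 ^ i) * \<mu>\<^sub>B ^ (3 ^ i) = \<mu>\<^sub>C * u ^ (3 ^ i) - u * \<mu>\<^sub>C ^ (3 ^ i)) \<and>
        \<alpha> \<in> subfield_of_order (3 ^ (3 * l)) \<and> lam \<in> subfield_of_order 3 \<and>
        g \<alpha> - \<alpha> = lam\<^sub>C * u + lam * \<mu>\<^sub>C \<and>
        S\<^sub>1 = lin_poly 3 (9 * l) s \<and>
        Q = (\<lambda>x. - abs_trace 3 (9 * l) (\<mu>\<^sub>B * x * poly S\<^sub>1 x)) \<and>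
        K = {z. abs_trace 3 (9 * l) (\<mu>\<^sub>C * z) = 0} \<and>
        G = GammaL4\<lparr>carrier := generate GammaL4
              ({(E_mat a b c (poly S\<^sub>1 c),
                 prime_field_pow (g ^^ 3) (1 / 2 * Q c + abs_trace 3 (9 * l) (\<alpha> * c + \<mu>\<^sub>B * b)))
                | a b c. c \<in> K}
               \<union> {(E_mat 0 0 t\<^sub>C (poly S\<^sub>1 t\<^sub>C), g)})\<rparr>)"

end

theory Submission
  imports Defs "HOL-Number_Theory.Residues"
begin

text \<open>
  Write \<open>r = p ^ e\<close> for the order of \<open>g\<close> and \<open>\<Delta> = g - 1\<close>, an additive endomorphism of the field. In
  characteristic \<open>p\<close> we have \<open>\<Delta> ^ r = g ^ r - 1 = 0\<close>, and \<open>\<Delta> ^ (r - 1) = 1 + g + \<dots> + g ^ (r - 1)\<close> is the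
  trace \<open>Tr\<close> to the fixed field of \<open>g\<close>. All three groups lie in the group of all \<open>(E(a, b, c, t), g ^ j)\<close>.
  Commutation acts on each of its abelian layers \<open>(c, t)\<close>, \<open>b\<close>, \<open>a\<close> through maps \<open>g ^ j - 1\<close>, all multiples
  of \<open>\<Delta>\<close>. Hence the lower central series drops through each layer in at most \<open>r\<close> steps, and the class is
  at most \<open>3r\<close>.

  For the lower bound, each group contains an element \<open>h = (E(\<dots>, c\<^sub>0, \<dots>), g)\<close> with \<open>Tr c\<^sub>0 \<noteq> 0\<close>, and all
  \<open>(E(0, b, 0, 0), 1)\<close> with \<open>tr (\<mu> b) = 0\<close>, for some nonzero \<open>\<mu>\<close> fixed by \<open>g\<close>. Commutation with \<open>h\<close> sends
  \<open>(a, b)\<close> to \<open>(\<Delta> a - 2 c\<^sub>0 g b, \<Delta> b)\<close>. After \<open>r - 1\<close> steps \<open>(0, b)\<close> becomes \<open>(a', Tr b)\<close>, one more step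
  gives \<open>(\<Delta> a' - 2 c\<^sub>0 Tr b, 0)\<close>, and another \<open>r - 1\<close> steps give \<open>(- 2 Tr c\<^sub>0 Tr b, 0)\<close>. Since \<open>l > 1\<close>, the
  fixed field of \<open>g\<close> contains some \<open>z\<close> outside the prime field; if \<open>tr (\<mu> w) = 1\<close>, then
  \<open>b = (z - tr (\<mu> z w)) w\<close> satisfies \<open>tr (\<mu> b) = 0\<close> and \<open>Tr b \<noteq> 0\<close>. So the class is at least \<open>2r\<close>.
\<close>

section \<open>Lower central series\<close>

context group
begin

lemma finite_subgroupI:
  assumes subset: "H \<subseteq> carrier G" and "finite H" "H \<noteq> {}"
    and closed: "\<And>x y. x \<in> H \<Longrightarrow> y \<in> H \<Longrightarrow> x \<otimes> y \<in> H"
  shows "subgroup H G"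
proof (rule subgroupI)
  fix a assume "a \<in> H"
  with subset have a: "a \<in> carrier G" by blast
  have "inj_on ((\<otimes>) a) H"
    using subset a by (meson inj_on_cmult inj_on_subset)
  moreover have "(\<otimes>) a ` H \<subseteq> H"
    using closed \<open>a \<in> H\<close> by blast
  ultimately have surj: "(\<otimes>) a ` H = H"
    using \<open>finite H\<close> by (simp add: endo_inj_surj)
  then obtain x where "x \<in> H" "a = a \<otimes> x"
    using \<open>a \<in> H\<close> by (metis imageE)
  then have "\<one> \<in> H"
    using subset a by (metis l_cancel_one subsetD)
  then obtain y where "y \<in> H" "\<one> = a \<otimes> y"
    using surj by (metis imageE)
  then show "inv a \<in> H"
    using subset a by (metis inv_char inv_comm subsetD)
qed (use assms in auto)

lemma subgroup_lower_central_series: "subgroup (lower_central_series G n) G"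
proof (induction n)
  case 0
  show ?case using subgroup_self by simp
next
  case (Suc n)
  show ?case
    unfolding lower_central_series.simps commutator_subgroup_def
    by (rule generate_is_subgroup) (use subgroup.subset[OF Suc] in blast)
qed

text \<open>Commutators are described by \<open>h x y = x h\<close>, that is \<open>y = x\<inverse> h\<inverse> x h\<close>. With \<open>y\<close> in the rightmost
  place, no automorphism is applied to it when this equation is evaluated in the semilinear group.\<close>

lemma commutator_eq:
  assumes eq: "h \<otimes> x \<otimes> y = x \<otimes> h" and carrier: "h \<in> carrier G" "x \<in> carrier G" "y \<in> carrier G"
  shows "y = inv x \<otimes> inv h \<otimes> x \<otimes> h"
proof -
  have "y = inv (h \<otimes> x) \<otimes> (x \<otimes> h)"
    using eq carrier by (simp add: inv_solve_left)
  then show ?thesis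
    using carrier by (simp add: inv_mult_group m_assoc)
qed

lemma commutator_unique:
  assumes "h \<otimes> x \<otimes> y = x \<otimes> h" "h \<otimes> x \<otimes> z = x \<otimes> h"
    and "h \<in> carrier G" "x \<in> carrier G" "y \<in> carrier G" "z \<in> carrier G"
  shows "y = z"
  using assms commutator_eq[of h x y] commutator_eq[of h x z] by simp

lemma commutator_in_subgroup:
  assumes "subgroup H G" "x \<in> H" "h \<in> H" "y \<in> carrier G" "h \<otimes> x \<otimes> y = x \<otimes> h"
  shows "y \<in> H"
  using assms commutator_eq[of h x y] by (simp add: subgroup.mem_carrier subgroup.m_closed subgroup.m_inv_closed)

lemma lower_central_series_SucI:
  assumes x: "x \<in> lower_central_series G n" and carrier: "h \<in> carrier G" "y \<in> carrier G"
    and eq: "h \<otimes> x \<otimes> y = x \<otimes> h"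
  shows "y \<in> lower_central_series G (Suc n)"
proof -
  note subgroup = subgroup_lower_central_series[of n]
  have "x \<in> carrier G"
    using x subgroup.subset[OF subgroup] by blast
  then have "y = inv x \<otimes> inv h \<otimes> inv (inv x) \<otimes> inv (inv h)"
    using eq carrier commutator_eq by simp
  then show ?thesis
    unfolding lower_central_series.simps commutator_subgroup_def
    using subgroup.m_inv_closed[OF subgroup x] carrier by (intro generate.incl) blast
qed

lemma lower_central_series_add_subset:
  assumes N: "\<And>k. subgroup (N k) G" and start: "lower_central_series G n \<subseteq> N 0"
    and commutator: "\<And>k x h y. x \<in> N k \<Longrightarrow> h \<in> carrier G \<Longrightarrow> y \<in> carrier G \<Longrightarrow>
      h \<otimes> x \<otimes> y = x \<otimes> h \<Longrightarrow> y \<in> N (Suc k)"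
  shows "lower_central_series G (n + k) \<subseteq> N k"
proof (induction k)
  case 0
  show ?case using start by simp
next
  case (Suc k)
  have "x \<otimes> h \<otimes> inv x \<otimes> inv h \<in> N (Suc k)"
    if "x \<in> lower_central_series G (n + k)" "h \<in> carrier G" for x h
  proof (rule commutator)
    have x: "x \<in> N k" "x \<in> carrier G"
      using that(1) Suc subgroup.subset[OF N] by blast+
    show "inv x \<in> N k"
      using N x(1) by (rule subgroup.m_inv_closed)
    show "inv h \<otimes> inv x \<otimes> (x \<otimes> h \<otimes> inv x \<otimes> inv h) = inv x \<otimes> inv h"
      using x(2) that(2) by (metis inv_mult_group inv_closed l_inv l_one m_assoc m_closed)
    show "inv h \<in> carrier G" "x \<otimes> h \<otimes> inv x \<otimes> inv h \<in> carrier G"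
      using x(2) that(2) by simp_all
  qed
  then show ?case
    unfolding add_Suc_right lower_central_series.simps commutator_subgroup_def
    by (intro generate_subgroup_incl[OF _ N]) blast
qed

lemma lower_central_series_eq_one_add:
  assumes "lower_central_series G n = {\<one>}"
  shows "lower_central_series G (n + k) = {\<one>}"
proof (induction k)
  case (Suc k)
  moreover have "{h \<otimes> x \<otimes> inv h \<otimes> inv x | h x. h \<in> {\<one>} \<and> x \<in> carrier G} = {\<one>}"
    by (auto simp: m_assoc intro!: exI[of _ \<one>])
  ultimately show ?case
    by (simp add: commutator_subgroup_def generate_one)
qed (use assms in simp)

lemma nilpotency_class_between:
  assumes "lower_central_series G n = {\<one>}" and "lower_central_series G k \<noteq> {\<one>}"
  shows "nilpotent_group G \<and> nilpotency_class G \<in> {Suc k..n}"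
proof -
  have "lower_central_series G (nilpotency_class G) = {\<one>}"
    unfolding nilpotency_class_def using assms(1) by (rule LeastI)
  then have "\<not> nilpotency_class G \<le> k"
    using assms(2) lower_central_series_eq_one_add by (metis le_add_diff_inverse)
  moreover have "nilpotency_class G \<le> n"
    unfolding nilpotency_class_def using assms(1) by (rule Least_le)
  ultimately show ?thesis
    using assms(1) group_axioms by (auto simp: nilpotent_group_def)
qed

end

section \<open>Difference operators in prime characteristic\<close>

lemma of_nat_choose_prime_power_CHAR:
  assumes "prime CHAR('a::comm_ring_1)" and "0 < k" "k < CHAR('a) ^ e"
  shows "of_nat (CHAR('a) ^ e choose k) = (0 :: 'a)"
proof -
  define m where "m = CHAR('a) ^ e"
  have "of_nat (m choose k) = Polynomial.coeff ([:1, 1 :: 'a:] ^ m) k"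
    using assms by (simp add: coeff_linear_poly_power m_def)
  also have "[:1, 1 :: 'a:] ^ m = (1 + Polynomial.monom 1 1) ^ m"
    by (simp add: monom_altdef one_pCons)
  also have "\<dots> = 1 ^ m + Polynomial.monom 1 1 ^ m"
    by (rule freshmans_dream'[where n = e]) (use assms in \<open>simp_all add: m_def\<close>)
  also have "Polynomial.coeff \<dots> k = 0"
    using assms by (simp add: monom_power coeff_monom m_def)
  finally show ?thesis
    by (simp add: m_def)
qed

lemma of_nat_choose_pred_prime_power_CHAR:
  assumes "prime CHAR('a::comm_ring_1)" and m: "m = CHAR('a) ^ e" and "k \<le> m - 1"
  shows "(- 1) ^ (m - 1 + k) * of_nat (m - 1 choose k) = (1 :: 'a)"
  using \<open>k \<le> m - 1\<close>
proof (induction k rule: inc_induct)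
  case base
  show ?case by (simp flip: mult_2)
next
  case (step k)
  then obtain m' where m': "m = Suc m'" "k < m'"
    by (cases m) auto
  have "of_nat (m choose Suc k) = (0 :: 'a)"
    using of_nat_choose_prime_power_CHAR[OF assms(1), of "Suc k" e] m' by (simp add: m)
  then have "of_nat (m - 1 choose k) = (- of_nat (m - 1 choose Suc k) :: 'a)"
    by (simp add: m' add_eq_0_iff)
  then show ?case
    using step.IH by simp
qed

definition difference :: "('a::ab_group_add \<Rightarrow> 'a) \<Rightarrow> 'a \<Rightarrow> 'a" where
  "difference f x = f x - x"

definition difference_range :: "('a::ab_group_add \<Rightarrow> 'a) \<Rightarrow> nat \<Rightarrow> 'a set" where
  "difference_range f k = range (difference f ^^ k)"

lemma difference_range_0: "difference_range f 0 = UNIV"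
  by (simp add: difference_range_def)

context
  fixes f :: "'a::ab_group_add \<Rightarrow> 'a"
  assumes additive: "Modules.additive f"
begin

lemma additive_funpow: "Modules.additive (f ^^ k)"
  by unfold_locales (induction k; simp add: additive.add[OF additive])

lemma difference_funpow_commute: "(difference f ^^ k) ((f ^^ j) x) = (f ^^ j) ((difference f ^^ k) x)"
proof -
  have "difference f ((f ^^ j) x) = (f ^^ j) (difference f x)" for x
    by (simp add: difference_def additive.diff[OF additive_funpow] funpow_swap1)
  then show ?thesis
    by (induction k) simp_all
qed

end

lemma additive_difference: "Modules.additive f \<Longrightarrow> Modules.additive (difference f)"
  by unfold_locales (simp add: difference_def additive.add)

context
  fixes f :: "'a::ab_group_add \<Rightarrow> 'a"
  assumes additive: "Modules.additive f"
begin

lemmas additive_difference_funpow = additive_funpow[OF additive_difference[OF additive]]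

lemma difference_range_zero: "0 \<in> difference_range f k"
  unfolding difference_range_def by (metis additive.zero additive_difference_funpow rangeI)

lemma difference_range_add:
  "x \<in> difference_range f k \<Longrightarrow> y \<in> difference_range f k \<Longrightarrow> x + y \<in> difference_range f k"
  by (auto simp: difference_range_def simp flip: additive.add[OF additive_difference_funpow])

lemma difference_range_funpow:
  assumes "x \<in> difference_range f k"
  shows "(f ^^ j) x \<in> difference_range f k"
proof -
  obtain y where "x = (difference f ^^ k) y"
    using assms by (auto simp: difference_range_def)
  then have "(f ^^ j) x = (difference f ^^ k) ((f ^^ j) y)"
    by (simp add: difference_funpow_commute[OF additive])
  then show ?thesis
    by (simp add: difference_range_def)
qed

lemma funpow_diff_in_difference_range_Suc:
  assumes "x \<in> difference_range f k"
  shows "(f ^^ j) x - x \<in> difference_range f (Suc k)"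
proof (induction j)
  case 0
  show ?case by (simp add: difference_range_zero)
next
  case (Suc j)
  have "difference f ((f ^^ j) x) \<in> difference_range f (Suc k)"
    using difference_range_funpow[OF assms, of j]
    by (auto simp: difference_range_def image_iff)
  from difference_range_add[OF this Suc] show ?case
    by (simp add: difference_def)
qed

end

lemma difference_funpow:
  fixes f :: "'a::comm_ring_1 \<Rightarrow> 'a"
  assumes "Modules.additive f"
  shows "(difference f ^^ n) x = (\<Sum>k\<le>n. (- 1) ^ (n + k) * of_nat (n choose k) * (f ^^ k) x)"
proof (induction n arbitrary: x)
  case (Suc n)
  define a where "a k = (- 1) ^ (n + k) * of_nat (n choose k) * (f ^^ k) x" for k
  define b where "b k = (- 1) ^ (n + k) * of_nat (n choose k) * (f ^^ Suc k) x" for k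
  have "(difference f ^^ Suc n) x = (\<Sum>k\<le>n. b k - a k)"
    unfolding funpow_Suc_right o_apply Suc a_def b_def difference_def
    by (simp add: additive.diff[OF additive_funpow[OF assms]] right_diff_distrib funpow_swap1)
  also have "\<dots> = (\<Sum>k\<le>n. b k) - (\<Sum>k\<le>Suc n. a k)"
    by (simp add: sum_subtractf a_def binomial_eq_0)
  also have "\<dots> = - a 0 + (\<Sum>k\<le>n. b k - a (Suc k))"
    by (simp add: sum.atMost_Suc_shift sum_subtractf del: sum.atMost_Suc)
  also have "\<dots> = (\<Sum>k\<le>Suc n. (- 1) ^ (Suc n + k) * of_nat (Suc n choose k) * (f ^^ k) x)"
    by (simp add: sum.atMost_Suc_shift a_def b_def algebra_simps del: sum.atMost_Suc funpow.simps(2))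
  finally show ?case .
qed simp

lemma difference_funpow_pred_prime_power_CHAR:
  fixes f :: "'a::comm_ring_1 \<Rightarrow> 'a"
  assumes "Modules.additive f" and "prime CHAR('a)" and m: "m = CHAR('a) ^ e"
  shows "(difference f ^^ (m - 1)) x = (\<Sum>k<m. (f ^^ k) x)"
proof -
  have "(difference f ^^ (m - 1)) x = (\<Sum>k\<le>m - 1. (f ^^ k) x)"
    unfolding difference_funpow[OF assms(1)]
    using of_nat_choose_pred_prime_power_CHAR[OF assms(2) m] by (intro sum.cong) simp_all
  moreover have "m > 0"
    using prime_gt_0_nat[OF assms(2)] by (simp add: m)
  then have "{..m - 1} = {..<m}"
    by auto
  ultimately show ?thesis by simp
qed

lemma difference_funpow_prime_power_CHAR:
  fixes f :: "'a::comm_ring_1 \<Rightarrow> 'a"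
  assumes f: "Modules.additive f" and "prime CHAR('a)" and m: "m = CHAR('a) ^ e"
  shows "(difference f ^^ m) x = (f ^^ m) x - x"
proof -
  have "m = Suc (m - 1)"
    using prime_gt_0_nat[OF assms(2)] by (simp add: m)
  then have "(difference f ^^ m) x = difference f ((difference f ^^ (m - 1)) x)"
    by (metis funpow.simps(2) o_apply)
  also have "\<dots> = (\<Sum>k<m. (f ^^ Suc k) x - (f ^^ k) x)"
    unfolding difference_funpow_pred_prime_power_CHAR[OF assms]
    by (simp add: difference_def additive.sum[OF f] sum_subtractf)
  also have "\<dots> = (f ^^ m) x - x"
    using sum_lessThan_telescope[of "\<lambda>k. (f ^^ k) x" m] by simp
  finally show ?thesis .
qed

section \<open>The semilinear group and its unipotent elements\<close>

lemma field_auts_additive: "\<sigma> \<in> field_auts \<Longrightarrow> Modules.additive \<sigma>"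
  by (rule additive.intro) (simp add: field_auts_def)

lemma field_auts_mult: "\<sigma> \<in> field_auts \<Longrightarrow> \<sigma> (x * y) = \<sigma> x * \<sigma> y"
  and field_auts_bij: "\<sigma> \<in> field_auts \<Longrightarrow> bij \<sigma>"
  by (simp_all add: field_auts_def)

lemma field_auts_1:
  assumes "\<sigma> \<in> field_auts"
  shows "\<sigma> 1 = 1"
proof -
  have "\<sigma> 1 \<noteq> \<sigma> 0"
    using field_auts_bij[OF assms] by (simp add: bij_is_inj inj_eq)
  then show ?thesis
    using field_auts_mult[OF assms, of 1 1] additive.zero[OF field_auts_additive[OF assms]] by simp
qed

lemmas field_auts_sum = additive.sum[OF field_auts_additive]

lemmas field_auts_hom = additive.add[OF field_auts_additive] additive.zero[OF field_auts_additive]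
  additive.minus[OF field_auts_additive] additive.diff[OF field_auts_additive]
  field_auts_mult field_auts_1

lemma field_auts_numeral: "\<sigma> \<in> field_auts \<Longrightarrow> \<sigma> (numeral n) = numeral n"
  by (induction n) (simp_all only: numeral.simps field_auts_hom)

lemma id_in_field_auts: "id \<in> field_auts"
  by (simp add: field_auts_def)

lemma comp_in_field_auts: "\<sigma> \<in> field_auts \<Longrightarrow> \<tau> \<in> field_auts \<Longrightarrow> \<sigma> \<circ> \<tau> \<in> field_auts"
  by (auto simp: field_auts_def intro: bij_comp)

lemma funpow_in_field_auts: "\<sigma> \<in> field_auts \<Longrightarrow> \<sigma> ^^ k \<in> field_auts"
  by (induction k) (simp_all only: funpow.simps id_in_field_auts comp_in_field_auts)

lemma inv_into_in_field_auts:
  assumes "\<sigma> \<in> field_auts"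
  shows "inv_into UNIV \<sigma> \<in> field_auts"
proof -
  note bij = field_auts_bij[OF assms]
  then have right_inverse: "\<sigma> (inv_into UNIV \<sigma> x) = x" for x
    by (simp add: bij_is_surj surj_f_inv_f)
  have "inv_into UNIV \<sigma> (x + y) = inv_into UNIV \<sigma> x + inv_into UNIV \<sigma> y"
    and "inv_into UNIV \<sigma> (x * y) = inv_into UNIV \<sigma> x * inv_into UNIV \<sigma> y" for x y
    by (rule injD[OF bij_is_inj[OF bij]], simp add: right_inverse field_auts_hom[OF assms])+
  then show ?thesis
    using bij by (simp add: field_auts_def bij_imp_bij_inv)
qed

lemma comp_inv_into_field_auts: "\<sigma> \<in> field_auts \<Longrightarrow> \<sigma> \<circ> inv_into UNIV \<sigma> = id"
  by (simp add: fun_eq_iff field_auts_bij bij_is_surj surj_f_inv_f)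

lemma group_Aut_field: "group (Aut_field :: ('a::field \<Rightarrow> 'a) monoid)"
proof (rule groupI)
  fix \<sigma> :: "'a \<Rightarrow> 'a" assume "\<sigma> \<in> carrier Aut_field"
  then show "\<exists>\<tau>\<in>carrier Aut_field. \<tau> \<otimes>\<^bsub>Aut_field\<^esub> \<sigma> = \<one>\<^bsub>Aut_field\<^esub>"
    by (intro bexI[of _ "inv_into UNIV \<sigma>"])
      (simp_all add: Aut_field_def inv_into_in_field_auts comp_inv_into_field_auts)
qed (auto simp: Aut_field_def id_in_field_auts comp_in_field_auts o_assoc)

lemma Aut_field_pow: "\<sigma> [^]\<^bsub>Aut_field\<^esub> (k :: nat) = \<sigma> ^^ k"
  by (induction k) (simp_all add: Aut_field_def nat_pow_def)

lemma map_matrix_comp: "map_matrix f (map_matrix g A) = map_matrix (f \<circ> g) A"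
  by (simp add: vec_eq_iff)

lemma map_matrix_id: "map_matrix id A = A"
  by (simp add: vec_eq_iff)

context
  fixes \<sigma> :: "'a::field \<Rightarrow> 'a"
  assumes \<sigma>: "\<sigma> \<in> field_auts"
begin

lemma map_matrix_mult: "map_matrix \<sigma> (A ** B) = map_matrix \<sigma> A ** map_matrix \<sigma> B"
  by (simp add: vec_eq_iff matrix_matrix_mult_def field_auts_sum[OF \<sigma>] field_auts_mult[OF \<sigma>])

lemma map_matrix_one: "map_matrix \<sigma> (mat 1) = mat 1"
  by (simp add: vec_eq_iff mat_def field_auts_hom[OF \<sigma>])

lemma invertible_map_matrix:
  fixes A :: "'a^'n^'n"
  assumes "invertible A"
  shows "invertible (map_matrix \<sigma> A)"
  using assms unfolding invertible_def by (metis map_matrix_mult map_matrix_one)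

end

lemma GammaL4_mult: "(A, \<sigma>) \<otimes>\<^bsub>GammaL4\<^esub> (B, \<tau>) = (map_matrix \<tau> A ** B, \<tau> \<circ> \<sigma>)"
  by (simp add: GammaL4_def Aut_field_def)

lemma GammaL4_carrier: "(A, \<sigma>) \<in> carrier GammaL4 \<longleftrightarrow> invertible A \<and> \<sigma> \<in> field_auts"
  by (simp add: GammaL4_def)

lemma GammaL4_one: "\<one>\<^bsub>GammaL4\<^esub> = (mat 1, id)"
  by (simp add: GammaL4_def)

lemma group_GammaL4: "group (GammaL4 :: 'a::field semilin monoid)"
proof (rule groupI)
  fix x :: "'a semilin" assume "x \<in> carrier GammaL4"
  then obtain A \<sigma> where x: "x = (A, \<sigma>)" "invertible A" "\<sigma> \<in> field_auts"
    by (cases x) (auto simp: GammaL4_carrier)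
  then obtain B where B: "B ** A = mat 1" "A ** B = mat 1"
    by (auto simp: invertible_def)
  then have "invertible B"
    by (auto simp: invertible_def)
  with x B show "\<exists>y\<in>carrier GammaL4. y \<otimes>\<^bsub>GammaL4\<^esub> x = \<one>\<^bsub>GammaL4\<^esub>"
    by (intro bexI[of _ "(map_matrix (inv_into UNIV \<sigma>) B, inv_into UNIV \<sigma>)"])
      (simp_all add: GammaL4_mult GammaL4_carrier GammaL4_one map_matrix_comp map_matrix_id
        invertible_map_matrix inv_into_in_field_auts comp_inv_into_field_auts)
qed (auto simp: GammaL4_mult GammaL4_carrier GammaL4_one map_matrix_comp map_matrix_id map_matrix_mult
    map_matrix_one invertible_map_matrix invertible_mult comp_in_field_auts id_in_field_auts
    matrix_mul_assoc o_assoc invertible_def[of "mat 1"])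

interpretation GammaL4: group "GammaL4 :: 'a::field semilin monoid"
  by (rule group_GammaL4)

lemma vector_4:
  "(vector [x, y, z, w] :: 'a::zero^4) $ 1 = x"
  "(vector [x, y, z, w] :: 'a::zero^4) $ 2 = y"
  "(vector [x, y, z, w] :: 'a::zero^4) $ 3 = z"
  "(vector [x, y, z, w] :: 'a::zero^4) $ 4 = w"
  unfolding vector_def by simp_all

lemma E_mat_nth:
  "E_mat a b c t $ 1 = vector [1, 0, 0, 0]" "E_mat a b c t $ 2 = vector [- c, 1, 0, 0]"
  "E_mat a b c t $ 3 = vector [b - c * t, t, 1, 0]" "E_mat a b c t $ 4 = vector [a, b, c, 1]"
  by (simp_all add: E_mat_def vector_4)

lemma E_mat_eq_iff: "E_mat a b c t = E_mat a' b' c' t' \<longleftrightarrow> a = a' \<and> b = b' \<and> c = c' \<and> t = t'"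
  by (auto simp: vec_eq_iff forall_4 E_mat_nth vector_4)

lemma E_mat_0: "E_mat 0 0 0 0 = mat 1"
  by (simp add: vec_eq_iff forall_4 E_mat_nth vector_4 mat_def)

lemma E_mat_mult:
  "E_mat a\<^sub>1 b\<^sub>1 c\<^sub>1 t\<^sub>1 ** E_mat a\<^sub>2 b\<^sub>2 c\<^sub>2 t\<^sub>2 =
     E_mat (a\<^sub>1 + a\<^sub>2 - b\<^sub>1 * c\<^sub>2 + c\<^sub>1 * b\<^sub>2 - c\<^sub>1 * c\<^sub>2 * t\<^sub>2) (b\<^sub>1 + b\<^sub>2 + c\<^sub>1 * t\<^sub>2)
       (c\<^sub>1 + c\<^sub>2) (t\<^sub>1 + t\<^sub>2)"
  by (simp add: vec_eq_iff forall_4 matrix_matrix_mult_def sum_4 E_mat_nth vector_4 algebra_simps)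

lemma invertible_E_mat: "invertible (E_mat a b c t)"
proof -
  have "E_mat a b c t ** E_mat (- a) (c * t - b) (- c) (- t) = mat 1"
       "E_mat (- a) (c * t - b) (- c) (- t) ** E_mat a b c t = mat 1"
    by (simp_all add: E_mat_mult E_mat_0[symmetric] E_mat_eq_iff algebra_simps)
  then show ?thesis
    by (auto simp: invertible_def)
qed

lemma map_matrix_E_mat: "\<sigma> \<in> field_auts \<Longrightarrow> map_matrix \<sigma> (E_mat a b c t) = E_mat (\<sigma> a) (\<sigma> b) (\<sigma> c) (\<sigma> t)"
  by (simp add: vec_eq_iff forall_4 E_mat_nth vector_4 field_auts_hom)

lemma GammaL4_mult_E_mat:
  assumes "\<tau> \<in> field_auts"
  shows "(E_mat a\<^sub>1 b\<^sub>1 c\<^sub>1 t\<^sub>1, \<sigma>) \<otimes>\<^bsub>GammaL4\<^esub> (E_mat a\<^sub>2 b\<^sub>2 c\<^sub>2 t\<^sub>2, \<tau>) =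
    (E_mat (\<tau> a\<^sub>1 + a\<^sub>2 - \<tau> b\<^sub>1 * c\<^sub>2 + \<tau> c\<^sub>1 * b\<^sub>2 - \<tau> c\<^sub>1 * c\<^sub>2 * t\<^sub>2) (\<tau> b\<^sub>1 + b\<^sub>2 + \<tau> c\<^sub>1 * t\<^sub>2)
       (\<tau> c\<^sub>1 + c\<^sub>2) (\<tau> t\<^sub>1 + t\<^sub>2), \<tau> \<circ> \<sigma>)"
  using assms by (simp add: GammaL4_mult map_matrix_E_mat E_mat_mult)

lemma E_mat_in_carrier_GammaL4: "\<sigma> \<in> field_auts \<Longrightarrow> (E_mat a b c t, \<sigma>) \<in> carrier GammaL4"
  by (simp add: GammaL4_carrier invertible_E_mat)

lemma ex_E_mat_right_quotient:
  "\<exists>a b. (E_mat a\<^sub>1 b\<^sub>1 c\<^sub>1 t\<^sub>1, \<rho>) \<otimes>\<^bsub>GammaL4\<^esub> (E_mat a b (c\<^sub>2 - c\<^sub>1) (t\<^sub>2 - t\<^sub>1), id) =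
    (E_mat a\<^sub>2 b\<^sub>2 c\<^sub>2 t\<^sub>2, \<rho>)"
proof (intro exI)
  let ?b = "b\<^sub>2 - b\<^sub>1 - c\<^sub>1 * (t\<^sub>2 - t\<^sub>1)"
  let ?a = "a\<^sub>2 - a\<^sub>1 + b\<^sub>1 * (c\<^sub>2 - c\<^sub>1) - c\<^sub>1 * ?b + c\<^sub>1 * (c\<^sub>2 - c\<^sub>1) * (t\<^sub>2 - t\<^sub>1)"
  show "(E_mat a\<^sub>1 b\<^sub>1 c\<^sub>1 t\<^sub>1, \<rho>) \<otimes>\<^bsub>GammaL4\<^esub> (E_mat ?a ?b (c\<^sub>2 - c\<^sub>1) (t\<^sub>2 - t\<^sub>1), id) =
      (E_mat a\<^sub>2 b\<^sub>2 c\<^sub>2 t\<^sub>2, \<rho>)"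
    by (simp add: GammaL4_mult_E_mat id_in_field_auts E_mat_eq_iff)
qed

lemma commutator_E_mat:
  assumes auts: "\<sigma> \<in> field_auts" "\<tau> \<in> field_auts" and commute: "\<sigma> \<circ> \<tau> = \<tau> \<circ> \<sigma>"
    and y: "y \<in> carrier GammaL4"
    and eq: "(E_mat a\<^sub>0 b\<^sub>0 c\<^sub>0 t\<^sub>0, \<tau>) \<otimes>\<^bsub>GammaL4\<^esub> (E_mat a b c t, \<sigma>) \<otimes>\<^bsub>GammaL4\<^esub> y =
      (E_mat a b c t, \<sigma>) \<otimes>\<^bsub>GammaL4\<^esub> (E_mat a\<^sub>0 b\<^sub>0 c\<^sub>0 t\<^sub>0, \<tau>)"
  obtains a' b' where "y = (E_mat a' b' (\<tau> c - c - (\<sigma> c\<^sub>0 - c\<^sub>0)) (\<tau> t - t - (\<sigma> t\<^sub>0 - t\<^sub>0)), id)"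
proof -
  have rearrange: "\<tau> z - z - (\<sigma> z\<^sub>0 - z\<^sub>0) = \<tau> z + z\<^sub>0 - (\<sigma> z\<^sub>0 + z)" for z z\<^sub>0
    by simp
  have "\<exists>a' b'. (E_mat a\<^sub>0 b\<^sub>0 c\<^sub>0 t\<^sub>0, \<tau>) \<otimes>\<^bsub>GammaL4\<^esub> (E_mat a b c t, \<sigma>) \<otimes>\<^bsub>GammaL4\<^esub>
      (E_mat a' b' (\<tau> c - c - (\<sigma> c\<^sub>0 - c\<^sub>0)) (\<tau> t - t - (\<sigma> t\<^sub>0 - t\<^sub>0)), id) =
      (E_mat a b c t, \<sigma>) \<otimes>\<^bsub>GammaL4\<^esub> (E_mat a\<^sub>0 b\<^sub>0 c\<^sub>0 t\<^sub>0, \<tau>)"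
    unfolding rearrange GammaL4_mult_E_mat[OF auts(1)] GammaL4_mult_E_mat[OF auts(2)] commute
    by (rule ex_E_mat_right_quotient)
  then obtain a' b' where "y = (E_mat a' b' (\<tau> c - c - (\<sigma> c\<^sub>0 - c\<^sub>0)) (\<tau> t - t - (\<sigma> t\<^sub>0 - t\<^sub>0)), id)"
    using y eq auts by (metis E_mat_in_carrier_GammaL4 GammaL4.commutator_unique id_in_field_auts)
  then show ?thesis by (rule that)
qed

definition E_ab :: "'a::field \<Rightarrow> 'a \<Rightarrow> 'a semilin" where
  "E_ab a b = (E_mat a b 0 0, id)"

lemma E_ab_mult: "E_ab a b \<otimes>\<^bsub>GammaL4\<^esub> E_ab a' b' = E_ab (a + a') (b + b')"
  by (simp add: E_ab_def GammaL4_mult_E_mat id_in_field_auts)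

lemma E_ab_eq_iff: "E_ab a b = E_ab a' b' \<longleftrightarrow> a = a' \<and> b = b'"
  by (simp add: E_ab_def E_mat_eq_iff)

lemma GammaL4_one_eq_E_ab: "\<one>\<^bsub>GammaL4\<^esub> = E_ab 0 0"
  by (simp add: GammaL4_one E_ab_def E_mat_0)

lemma E_ab_in_carrier_GammaL4: "E_ab a b \<in> carrier GammaL4"
  by (simp add: E_ab_def E_mat_in_carrier_GammaL4 id_in_field_auts)

lemma commutator_E_ab:
  assumes "\<tau> \<in> field_auts"
  shows "(E_mat a\<^sub>0 b\<^sub>0 c\<^sub>0 t\<^sub>0, \<tau>) \<otimes>\<^bsub>GammaL4\<^esub> E_ab a b \<otimes>\<^bsub>GammaL4\<^esub>
      E_ab (\<tau> a - a - 2 * c\<^sub>0 * \<tau> b) (\<tau> b - b) =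
    E_ab a b \<otimes>\<^bsub>GammaL4\<^esub> (E_mat a\<^sub>0 b\<^sub>0 c\<^sub>0 t\<^sub>0, \<tau>)"
  using assms
  by (simp add: E_ab_def GammaL4_mult_E_mat id_in_field_auts field_auts_hom E_mat_eq_iff algebra_simps)

section \<open>Powers of the Frobenius automorphism and traces\<close>

text \<open>The library proves this for the class \<open>finite_field\<close>, to which a type of sort \<open>{field,finite}\<close> does
  not formally belong.\<close>

lemma finite_field_power_card: "(x :: 'a::{field,finite}) ^ CARD('a) = x"
proof (cases "x = 0")
  case False
  have "bij_betw ((*) x) (UNIV - {0}) (UNIV - {0})"
    using False by (intro bij_betw_byWitness[where f' = "\<lambda>y. y / x"]) auto
  then have "\<Prod>(UNIV - {0}) = (\<Prod>y\<in>UNIV - {0}. x * y)"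
    by (rule prod.reindex_bij_betw[symmetric])
  also have "\<dots> = x ^ (CARD('a) - 1) * \<Prod>(UNIV - {0})"
    by (simp add: prod.distrib card_Diff_singleton)
  finally have "x ^ (CARD('a) - 1) = 1"
    by simp
  moreover have "x ^ CARD('a) = x * x ^ (CARD('a) - 1)"
    by (metis finite_UNIV_card_ge_0 finite_class.finite_UNIV power_minus_mult mult.commute)
  ultimately show ?thesis
    by simp
qed simp

lemma ex_sum_frobenius_powers_neq_0:
  fixes s :: "'b \<Rightarrow> 'a::{field,finite}"
  assumes p: "p > 1" and card: "CARD('a) = p ^ n"
    and J: "finite J" "inj_on d J" "\<And>j. j \<in> J \<Longrightarrow> d j < n" and i: "i \<in> J" "s i \<noteq> 0"
  shows "\<exists>x. (\<Sum>j\<in>J. s j * x ^ (p ^ d j)) \<noteq> 0"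
proof (rule ccontr)
  define P where "P = (\<Sum>j\<in>J. Polynomial.monom (s j) (p ^ d j))"
  assume "\<nexists>x. (\<Sum>j\<in>J. s j * x ^ (p ^ d j)) \<noteq> 0"
  then have "poly P x = poly 0 x" for x
    by (simp add: P_def poly_sum poly_monom)
  moreover have "degree P < CARD('a)"
    unfolding P_def card using p J(3)
    by (intro degree_sum_less) (auto intro: le_less_trans[OF degree_monom_le] power_strict_increasing)
  ultimately have "P = 0"
    by (intro poly_eqI_degree[of UNIV]) simp_all
  moreover have "Polynomial.coeff P (p ^ d i) = (\<Sum>j\<in>J. if j = i then s j else 0)"
    unfolding P_def coeff_sum coeff_monom using p J(2) i(1)
    by (intro sum.cong) (auto simp: inj_on_eq_iff)
  ultimately show False
    using J(1) i by simp
qed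

locale frobenius_extension =
  fixes p r l :: nat and g :: "'a::{field,finite} \<Rightarrow> 'a"
  assumes prime_p: "prime p" and card_eq: "CARD('a) = p ^ (r * l)" and g_eq: "g = (\<lambda>x. x ^ (p ^ l))"
begin

lemma p_gt_1: "p > 1"
  using prime_p by (rule prime_gt_1_nat)

lemma r_pos: "r > 0" and l_pos: "l > 0"
proof -
  have "card {0, 1 :: 'a} \<le> CARD('a)"
    by (rule card_mono) simp_all
  then have "r * l \<noteq> 0"
    unfolding card_eq by (intro notI) simp
  then show "r > 0" "l > 0" by simp_all
qed

lemma CHAR_eq: "CHAR('a) = p"
proof -
  have "prime CHAR('a)"
    by (simp add: prime_CHAR_semidom finite_imp_CHAR_pos)
  moreover have "CHAR('a) dvd p ^ (r * l)"
    using CHAR_dvd_CARD[where 'a = 'a] by (simp add: card_eq)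
  ultimately show ?thesis
    using prime_p by (meson prime_dvd_power primes_dvd_imp_eq)
qed

lemma two_neq_0:
  assumes "odd p"
  shows "(2 :: 'a) \<noteq> 0"
proof -
  have "\<not> p dvd 2"
    using prime_p assms by (metis dvd_refl primes_dvd_imp_eq two_is_prime_nat)
  then show ?thesis
    using of_nat_eq_0_iff_char_dvd[where 'a = 'a, of 2] by (simp add: CHAR_eq)
qed

lemma frobenius_in_field_auts: "(\<lambda>x :: 'a. x ^ (p ^ i)) \<in> field_auts"
proof -
  have add: "(x + y) ^ (p ^ i) = x ^ (p ^ i) + y ^ (p ^ i)" for x y :: 'a
    by (rule freshmans_dream'[where n = i]) (simp_all add: CHAR_eq prime_p)
  have "inj (\<lambda>x :: 'a. x ^ (p ^ i))"
  proof (rule injI)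
    fix x y :: 'a assume "x ^ (p ^ i) = y ^ (p ^ i)"
    then have "(x - y) ^ (p ^ i) = 0"
      using add[of "x - y" y] by simp
    then show "x = y" by simp
  qed
  then show ?thesis
    by (simp add: field_auts_def add power_mult_distrib bij_def finite_UNIV_inj_surj)
qed

lemmas frobenius_hom = field_auts_hom[OF frobenius_in_field_auts]
  and frobenius_sum = field_auts_sum[OF frobenius_in_field_auts]

lemma g_in_field_auts: "g \<in> field_auts"
  unfolding g_eq by (rule frobenius_in_field_auts)

lemmas g_hom = field_auts_hom[OF g_in_field_auts]
  and g_additive = field_auts_additive[OF g_in_field_auts]
  and g_funpow_in_field_auts = funpow_in_field_auts[OF g_in_field_auts]
  and g_funpow_hom = field_auts_hom[OF funpow_in_field_auts[OF g_in_field_auts]]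

lemma g_funpow: "(g ^^ j) x = x ^ (p ^ (l * j))"
  by (induction j) (simp_all add: g_eq power_add mult.commute flip: power_mult)

lemma g_funpow_r: "g ^^ r = id"
  using finite_field_power_card[where 'a = 'a] by (simp add: fun_eq_iff g_funpow card_eq mult.commute)

lemma g_funpow_fixed: "g x = x \<Longrightarrow> (g ^^ j) x = x"
  by (induction j) simp_all

lemma g_funpow_commute: "g ^^ i \<circ> g ^^ j = g ^^ j \<circ> g ^^ i"
  by (simp add: add.commute flip: funpow_add)

lemma ord_g: "group.ord Aut_field g = r"
proof -
  interpret Aut: group "Aut_field :: ('a \<Rightarrow> 'a) monoid"
    by (rule group_Aut_field)
  have pow_eq_one_iff: "g [^]\<^bsub>Aut_field\<^esub> k = \<one>\<^bsub>Aut_field\<^esub> \<longleftrightarrow> g ^^ k = id" for k :: nat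
    by (simp add: Aut_field_pow) (simp add: Aut_field_def)
  have g: "g \<in> carrier Aut_field"
    by (simp add: Aut_field_def g_in_field_auts)
  have "Aut.ord g dvd r"
    using Aut.pow_eq_id[OF g, of r] pow_eq_one_iff g_funpow_r by simp
  moreover have "\<not> Aut.ord g < r"
  proof
    define k where "k = Aut.ord g"
    assume "Aut.ord g < r"
    then have "k < r" by (simp add: k_def)
    have "k \<noteq> 0"
      using \<open>Aut.ord g dvd r\<close> r_pos by (auto simp: k_def)
    define s where "s j = (if j = 0 then - 1 else 1 :: 'a)" for j :: nat
    have "\<exists>x :: 'a. (\<Sum>j\<in>{0, k}. s j * x ^ (p ^ (l * j))) \<noteq> 0"
      by (rule ex_sum_frobenius_powers_neq_0[OF p_gt_1 card_eq, where i = 0])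
        (use \<open>k < r\<close> r_pos l_pos in \<open>auto simp: s_def inj_on_def\<close>)
    then have "\<exists>x. (g ^^ k) x \<noteq> x"
      using \<open>k \<noteq> 0\<close> by (simp add: s_def g_funpow)
    moreover have "g ^^ k = id"
      using Aut.pow_ord_eq_1[OF g] pow_eq_one_iff by (simp add: k_def)
    ultimately show False by simp
  qed
  ultimately show ?thesis
    using r_pos by (meson dvd_imp_le le_neq_implies_less)
qed

definition rel_trace :: "'a \<Rightarrow> 'a" where
  "rel_trace x = (\<Sum>j<r. (g ^^ j) x)"

abbreviation tr :: "'a \<Rightarrow> 'a" where
  "tr \<equiv> abs_trace p (r * l)"

lemma tr_additive: "Modules.additive tr"
  by (rule additive.intro) (simp add: abs_trace_def frobenius_hom sum.distrib)

lemmas tr_hom = additive.add[OF tr_additive] additive.zero[OF tr_additive]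
  additive.minus[OF tr_additive] additive.diff[OF tr_additive]
  and tr_sum = additive.sum[OF tr_additive]

lemma tr_power_p: "tr (x ^ p) = tr x" and tr_in_prime_field: "tr x ^ p = tr x"
proof -
  define n where "n = r * l"
  have shift: "(\<Sum>i<n. x ^ (p ^ Suc i)) = tr x"
    using sum.lessThan_Suc_shift[of "\<lambda>i. x ^ (p ^ i)" n] finite_field_power_card[of x]
    by (simp add: card_eq abs_trace_def n_def)
  show "tr (x ^ p) = tr x"
    using shift by (simp add: abs_trace_def n_def flip: power_mult)
  show "tr x ^ p = tr x"
    using shift frobenius_sum[of "\<lambda>i. x ^ (p ^ i)" "{..<n}" 1]
    by (simp add: abs_trace_def n_def mult.commute[of p] flip: power_mult)
qed

lemma tr_frobenius: "tr (x ^ (p ^ i)) = tr x"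
  by (induction i) (simp_all add: power_mult tr_power_p mult.commute[of p])

lemma tr_mult_g_funpow:
  assumes "g \<mu> = \<mu>"
  shows "tr (\<mu> * (g ^^ j) x) = tr (\<mu> * x)"
proof -
  have "\<mu> * (g ^^ j) x = (g ^^ j) (\<mu> * x)"
    by (simp add: g_funpow_hom g_funpow_fixed[OF assms])
  then show ?thesis
    by (simp add: g_funpow tr_frobenius)
qed

lemma power_p_power_fixed: "z ^ p = (z :: 'a) \<Longrightarrow> z ^ (p ^ i) = z"
  by (induction i) (simp_all add: power_mult)

lemma tr_scale: "z ^ p = z \<Longrightarrow> tr (z * x) = z * tr x"
  by (simp add: abs_trace_def power_mult_distrib power_p_power_fixed sum_distrib_left)

lemma rel_trace_diff: "rel_trace (x - y) = rel_trace x - rel_trace y"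
  by (simp add: rel_trace_def g_funpow_hom sum_subtractf)

lemma rel_trace_scale:
  assumes "g z = z"
  shows "rel_trace (z * x) = z * rel_trace x"
  by (simp add: rel_trace_def g_funpow_hom g_funpow_fixed[OF assms] sum_distrib_left)

lemma g_rel_trace: "g (rel_trace x) = rel_trace x"
proof -
  have "(\<Sum>j<r. (g ^^ Suc j) x) = (\<Sum>j<r. (g ^^ j) x)"
    using sum.lessThan_Suc_shift[of "\<lambda>j. (g ^^ j) x" r]
    by (simp add: g_funpow_r del: funpow.simps(2))
  then show ?thesis
    by (simp add: rel_trace_def field_auts_sum[OF g_in_field_auts])
qed

lemma tr_eq_sum_rel_trace: "tr x = (\<Sum>i<l. rel_trace x ^ (p ^ i))"
proof -
  have "(\<Sum>i\<in>{j * l..<j * l + l}. x ^ (p ^ i)) = (\<Sum>i<l. (g ^^ j) x ^ (p ^ i))" for j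
  proof -
    have "(\<Sum>i\<in>{j * l..<j * l + l}. x ^ (p ^ i)) = (\<Sum>i<l. x ^ (p ^ (i + j * l)))"
      using sum.shift_bounds_nat_ivl[of "\<lambda>i. x ^ (p ^ i)" 0 "j * l" l]
      by (simp add: add.commute lessThan_atLeast0)
    then show ?thesis
      by (simp add: g_funpow power_add mult.commute flip: power_mult)
  qed
  then have "tr x = (\<Sum>j<r. \<Sum>i<l. (g ^^ j) x ^ (p ^ i))"
    by (simp add: abs_trace_def flip: sum.nat_group)
  also have "\<dots> = (\<Sum>i<l. rel_trace x ^ (p ^ i))"
    unfolding rel_trace_def frobenius_sum by (rule sum.swap)
  finally show ?thesis .
qed

lemma rel_trace_neq_0I:
  assumes "g \<mu> = \<mu>" "tr (\<mu> * x) \<noteq> 0"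
  shows "rel_trace x \<noteq> 0"
proof
  assume "rel_trace x = 0"
  then have "tr (\<mu> * x) = (\<Sum>i<l. 0 ^ (p ^ i))"
    by (simp add: tr_eq_sum_rel_trace rel_trace_scale[OF assms(1)])
  then show False
    using assms(2) p_gt_1 by (simp add: power_0_left)
qed

lemma tr_mult_surj:
  assumes "\<mu> \<noteq> 0" "y ^ p = y"
  obtains x where "tr (\<mu> * x) = y"
proof -
  have "\<exists>x :: 'a. (\<Sum>i<r * l. 1 * x ^ (p ^ i)) \<noteq> 0"
    by (rule ex_sum_frobenius_powers_neq_0[OF p_gt_1 card_eq, where i = 0])
      (use r_pos l_pos in simp_all)
  then obtain w where w: "tr w \<noteq> 0"
    by (auto simp: abs_trace_def)
  have "(y / tr w) ^ p = y / tr w"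
    by (simp add: power_divide assms(2) tr_in_prime_field)
  then have "tr (\<mu> * (y / tr w * w / \<mu>)) = y"
    using w assms(1) tr_scale[of "y / tr w" w] by simp
  then show ?thesis by (rule that)
qed

lemma ex_fixed_not_in_prime_field:
  assumes "l > 1"
  obtains z where "g z = z" "z ^ p \<noteq> z"
proof -
  define d where "d = (\<lambda>(j, i :: nat). l * j + i)"
  define s where "s = (\<lambda>(j :: nat, i :: nat). if i = 0 then - 1 else 1 :: 'a)"
  have "{0, 1} \<subseteq> {..<l}"
    using assms by auto
  moreover have "inj_on d ({..<r} \<times> {..<l})"
    by (rule inj_on_inverseI[where g = "\<lambda>k. (k div l, k mod l)"]) (auto simp: d_def)
  ultimately have "inj_on d ({..<r} \<times> {0, 1})"
    by (meson Sigma_mono inj_on_subset order_refl)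
  moreover have "d (j, i) < r * l" if "j < r" "i \<in> {0, 1}" for j i
  proof -
    have "d (j, i) < l * Suc j"
      using that(2) assms by (auto simp: d_def)
    also have "\<dots> \<le> l * r"
      using that(1) by (intro mult_le_mono2) simp
    finally show ?thesis
      by (simp add: mult.commute)
  qed
  ultimately have "\<exists>x :: 'a. (\<Sum>j\<in>{..<r} \<times> {0, 1}. s j * x ^ (p ^ d j)) \<noteq> 0"
    by (intro ex_sum_frobenius_powers_neq_0[OF p_gt_1 card_eq, where i = "(0, 0)"])
      (use r_pos in \<open>auto simp: s_def\<close>)
  then obtain x :: 'a where "(\<Sum>j<r. x ^ (p ^ (l * j + 1)) - x ^ (p ^ (l * j))) \<noteq> 0"
    by (auto simp: s_def d_def sum.cartesian_product')
  then have "rel_trace x ^ p \<noteq> rel_trace x"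
    using frobenius_sum[of "\<lambda>j. (g ^^ j) x" "{..<r}" 1]
    by (simp add: rel_trace_def g_funpow sum_subtractf mult.commute flip: power_mult)
  then show ?thesis
    using that g_rel_trace by blast
qed

lemma ex_tr_eq_0_rel_trace_neq_0:
  assumes "l > 1" "\<mu> \<noteq> 0" "g \<mu> = \<mu>"
  obtains b where "tr (\<mu> * b) = 0" "rel_trace b \<noteq> 0"
proof -
  obtain z where z: "g z = z" "z ^ p \<noteq> z"
    using assms(1) by (rule ex_fixed_not_in_prime_field)
  obtain w where w: "tr (\<mu> * w) = 1"
    using tr_mult_surj[OF assms(2), of 1] by auto
  define c where "c = tr (\<mu> * (z * w))"
  have c: "c ^ p = c" "g c = c"
    by (simp_all add: c_def tr_in_prime_field g_eq power_p_power_fixed)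
  have "tr (\<mu> * (z * w - c * w)) = 0"
    using tr_scale[OF c(1), of "\<mu> * w"]
    by (simp add: right_diff_distrib tr_hom w mult.left_commute flip: c_def)
  moreover have "rel_trace (z * w - c * w) = (z - c) * rel_trace w"
    by (simp add: rel_trace_diff rel_trace_scale z(1) c(2) left_diff_distrib)
  moreover have "rel_trace w \<noteq> 0"
    using assms(3) by (rule rel_trace_neq_0I) (simp add: w)
  moreover have "z \<noteq> c"
    using z(2) c(1) by blast
  ultimately show ?thesis
    using that by simp
qed

lemma card_prime_field_le: "card {x :: 'a. x ^ p = x} \<le> p"
proof -
  define P where "P = Polynomial.monom (1 :: 'a) p - Polynomial.monom 1 1"
  have "Polynomial.coeff P p = 1"
    using p_gt_1 by (simp add: P_def coeff_monom)
  then have "P \<noteq> 0" by auto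
  moreover have "degree P \<le> p"
    unfolding P_def using p_gt_1 by (intro degree_diff_le) (auto simp: degree_monom_eq)
  ultimately show ?thesis
    using card_poly_roots_bound[of P] by (simp add: P_def poly_monom)
qed

lemma prime_field_eq_of_nat:
  assumes "(x :: 'a) ^ p = x"
  obtains k where "x = of_nat k"
proof -
  have "(of_nat k :: 'a) ^ p = of_nat k" for k
    using frobenius_hom(1)[of _ _ 1] p_gt_1 by (induction k) simp_all
  then have "of_nat ` {..<p} \<subseteq> {x :: 'a. x ^ p = x}"
    by auto
  moreover have "card (of_nat ` {..<p} :: 'a set) = p"
    by (subst card_image) (auto simp: inj_on_def of_nat_eq_iff_cong_CHAR CHAR_eq cong_def)
  ultimately have "of_nat ` {..<p} = {x :: 'a. x ^ p = x}"
    using card_prime_field_le by (intro card_seteq) auto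
  then show ?thesis
    using assms that by blast
qed

end

section \<open>Bounds for the nilpotency class\<close>

context frobenius_extension
begin

definition E_frobenius :: "'a semilin set" where
  "E_frobenius = {(E_mat a b c t, g ^^ j) | a b c t j. True}"

lemma E_frobenius_subset: "E_frobenius \<subseteq> carrier GammaL4"
  by (auto simp: E_frobenius_def E_mat_in_carrier_GammaL4 g_funpow_in_field_auts)

definition E_central_filtration :: "(nat \<Rightarrow> 'a semilin set) \<Rightarrow> bool" where
  "E_central_filtration N \<longleftrightarrow> (\<forall>k. \<one>\<^bsub>GammaL4\<^esub> \<in> N k \<and> (\<forall>x\<in>N k. \<forall>y\<in>N k. x \<otimes>\<^bsub>GammaL4\<^esub> y \<in> N k) \<and>
     (\<forall>x\<in>N k. \<forall>h\<in>E_frobenius. \<forall>y\<in>carrier GammaL4.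
        h \<otimes>\<^bsub>GammaL4\<^esub> x \<otimes>\<^bsub>GammaL4\<^esub> y = x \<otimes>\<^bsub>GammaL4\<^esub> h \<longrightarrow> y \<in> N (Suc k)))"

definition ct_layer :: "nat \<Rightarrow> 'a semilin set" where
  "ct_layer k = {(E_mat a b c t, g ^^ j) | a b c t j.
     c \<in> difference_range g k \<and> t \<in> difference_range g k \<and> (k > 0 \<longrightarrow> j = 0)}"

definition ab_layer :: "'a set \<Rightarrow> 'a set \<Rightarrow> 'a semilin set" where
  "ab_layer A B = {E_ab a b | a b. a \<in> A \<and> b \<in> B}"

lemmas g_range_zero = difference_range_zero[OF g_additive]
  and g_range_add = difference_range_add[OF g_additive]
  and g_range_funpow = difference_range_funpow[OF g_additive]
  and g_range_Suc = funpow_diff_in_difference_range_Suc[OF g_additive]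

lemma ct_layer_mult:
  assumes "x \<in> ct_layer k" "y \<in> ct_layer k"
  shows "x \<otimes>\<^bsub>GammaL4\<^esub> y \<in> ct_layer k"
proof -
  obtain a b c t i where x: "x = (E_mat a b c t, g ^^ i)" "k > 0 \<longrightarrow> i = 0"
    "c \<in> difference_range g k" "t \<in> difference_range g k"
    using assms(1) unfolding ct_layer_def by blast
  obtain a' b' c' t' j where y: "y = (E_mat a' b' c' t', g ^^ j)" "k > 0 \<longrightarrow> j = 0"
    "c' \<in> difference_range g k" "t' \<in> difference_range g k"
    using assms(2) unfolding ct_layer_def by blast
  have "(g ^^ j) c + c' \<in> difference_range g k" "(g ^^ j) t + t' \<in> difference_range g k"
    using x y by (simp_all add: g_range_add g_range_funpow)
  moreover have "k > 0 \<longrightarrow> j + i = 0"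
    using x(2) y(2) by simp
  ultimately show ?thesis
    unfolding x(1) y(1) GammaL4_mult_E_mat[OF g_funpow_in_field_auts] funpow_add[symmetric] ct_layer_def
    by blast
qed

lemma E_frobenius_eq_ct_layer: "E_frobenius = ct_layer 0"
  by (auto simp: E_frobenius_def ct_layer_def difference_range_0)

lemma subgroup_E_frobenius: "subgroup E_frobenius GammaL4"
proof (rule GammaL4.finite_subgroupI[OF E_frobenius_subset])
  show "E_frobenius \<noteq> {}"
    unfolding E_frobenius_def by blast
qed (simp_all add: E_frobenius_eq_ct_layer ct_layer_mult)

lemma commutator_in_ct_layer:
  assumes "x \<in> ct_layer k" "h \<in> E_frobenius" "y \<in> carrier GammaL4"
    and "h \<otimes>\<^bsub>GammaL4\<^esub> x \<otimes>\<^bsub>GammaL4\<^esub> y = x \<otimes>\<^bsub>GammaL4\<^esub> h"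
  shows "y \<in> ct_layer (Suc k)"
proof -
  obtain a b c t i where x: "x = (E_mat a b c t, g ^^ i)" "k > 0 \<longrightarrow> i = 0"
    "c \<in> difference_range g k" "t \<in> difference_range g k"
    using assms(1) unfolding ct_layer_def by blast
  obtain a\<^sub>0 b\<^sub>0 c\<^sub>0 t\<^sub>0 j where h: "h = (E_mat a\<^sub>0 b\<^sub>0 c\<^sub>0 t\<^sub>0, g ^^ j)"
    using assms(2) unfolding E_frobenius_def by blast
  obtain a' b' where y: "y = (E_mat a' b' ((g ^^ j) c - c - ((g ^^ i) c\<^sub>0 - c\<^sub>0))
      ((g ^^ j) t - t - ((g ^^ i) t\<^sub>0 - t\<^sub>0)), id)"
    using commutator_E_mat[OF g_funpow_in_field_auts g_funpow_in_field_auts g_funpow_commute assms(3)]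
      assms(4) unfolding x(1) h by blast
  have "(g ^^ j) z - z - ((g ^^ i) z\<^sub>0 - z\<^sub>0) \<in> difference_range g (Suc k)"
    if "z \<in> difference_range g k" for z z\<^sub>0
  proof -
    have "(g ^^ i) (- z\<^sub>0) - (- z\<^sub>0) \<in> difference_range g (Suc k)"
    proof (cases "k = 0")
      case True
      then show ?thesis
        using g_range_Suc[of "- z\<^sub>0" 0 i] by (simp add: difference_range_0)
    next
      case False
      then show ?thesis
        using x(2) g_range_zero by simp
    qed
    then have "((g ^^ j) z - z) + ((g ^^ i) (- z\<^sub>0) - (- z\<^sub>0)) \<in> difference_range g (Suc k)"
      by (rule g_range_add[OF g_range_Suc[OF that]])
    also have "((g ^^ j) z - z) + ((g ^^ i) (- z\<^sub>0) - (- z\<^sub>0)) = (g ^^ j) z - z - ((g ^^ i) z\<^sub>0 - z\<^sub>0)"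
      by (simp add: g_funpow_hom)
    finally show ?thesis .
  qed
  with x(3,4) show ?thesis
    unfolding y ct_layer_def funpow.simps(1)[of g, symmetric] by blast
qed

lemma commutator_E_abE:
  assumes h: "h \<in> E_frobenius" and y: "y \<in> carrier GammaL4"
    and eq: "h \<otimes>\<^bsub>GammaL4\<^esub> E_ab a b \<otimes>\<^bsub>GammaL4\<^esub> y = E_ab a b \<otimes>\<^bsub>GammaL4\<^esub> h"
  obtains c j where "y = E_ab ((g ^^ j) a - a - 2 * c * (g ^^ j) b) ((g ^^ j) b - b)"
proof -
  obtain a\<^sub>0 b\<^sub>0 c\<^sub>0 t\<^sub>0 j where h: "h = (E_mat a\<^sub>0 b\<^sub>0 c\<^sub>0 t\<^sub>0, g ^^ j)"
    using h unfolding E_frobenius_def by blast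
  have "y = E_ab ((g ^^ j) a - a - 2 * c\<^sub>0 * (g ^^ j) b) ((g ^^ j) b - b)"
    by (rule GammaL4.commutator_unique[OF eq[unfolded h] commutator_E_ab[OF g_funpow_in_field_auts]])
      (simp_all add: y E_mat_in_carrier_GammaL4 g_funpow_in_field_auts E_ab_in_carrier_GammaL4)
  then show ?thesis by (rule that)
qed

lemma E_central_filtration_ct_layer: "E_central_filtration ct_layer"
proof -
  have "(E_mat 0 0 0 0, g ^^ 0) \<in> ct_layer k" for k
    unfolding ct_layer_def using g_range_zero by blast
  then have "\<one>\<^bsub>GammaL4\<^esub> \<in> ct_layer k" for k
    by (simp only: GammaL4_one E_mat_0 funpow.simps(1))
  then show ?thesis
    unfolding E_central_filtration_def using ct_layer_mult commutator_in_ct_layer by blast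
qed

lemma E_central_filtration_ab_layer:
  assumes zero: "\<And>k. 0 \<in> A k" "\<And>k. 0 \<in> B k"
    and add: "\<And>k x y. x \<in> A k \<Longrightarrow> y \<in> A k \<Longrightarrow> x + y \<in> A k"
      "\<And>k x y. x \<in> B k \<Longrightarrow> y \<in> B k \<Longrightarrow> x + y \<in> B k"
    and commutator: "\<And>k a b c j. a \<in> A k \<Longrightarrow> b \<in> B k \<Longrightarrow> (g ^^ j) a - a - 2 * c * (g ^^ j) b \<in> A (Suc k)"
      "\<And>k b j. b \<in> B k \<Longrightarrow> (g ^^ j) b - b \<in> B (Suc k)"
  shows "E_central_filtration (\<lambda>k. ab_layer (A k) (B k))"
proof -
  have "\<one>\<^bsub>GammaL4\<^esub> \<in> ab_layer (A k) (B k)" for k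
    unfolding ab_layer_def GammaL4_one_eq_E_ab using zero by blast
  moreover have "x \<otimes>\<^bsub>GammaL4\<^esub> y \<in> ab_layer (A k) (B k)"
    if "x \<in> ab_layer (A k) (B k)" "y \<in> ab_layer (A k) (B k)" for x y k
    using that by (auto simp: ab_layer_def E_ab_mult E_ab_eq_iff intro: add)
  moreover have "y \<in> ab_layer (A (Suc k)) (B (Suc k))"
    if x: "x \<in> ab_layer (A k) (B k)" and y: "h \<in> E_frobenius" "y \<in> carrier GammaL4"
      "h \<otimes>\<^bsub>GammaL4\<^esub> x \<otimes>\<^bsub>GammaL4\<^esub> y = x \<otimes>\<^bsub>GammaL4\<^esub> h" for x h y k
  proof -
    obtain a b where ab: "x = E_ab a b" "a \<in> A k" "b \<in> B k"
      using x unfolding ab_layer_def by blast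
    obtain c j where "y = E_ab ((g ^^ j) a - a - 2 * c * (g ^^ j) b) ((g ^^ j) b - b)"
      using y unfolding ab(1) by (rule commutator_E_abE)
    with ab(2,3) commutator show ?thesis
      unfolding ab_layer_def by blast
  qed
  ultimately show ?thesis
    unfolding E_central_filtration_def by blast
qed

lemma E_central_filtration_b_layer: "E_central_filtration (\<lambda>k. ab_layer UNIV (difference_range g k))"
  by (rule E_central_filtration_ab_layer) (simp_all add: g_range_zero g_range_add g_range_Suc)

lemma E_central_filtration_a_layer: "E_central_filtration (\<lambda>k. ab_layer (difference_range g k) {0})"
  by (rule E_central_filtration_ab_layer) (simp_all add: g_range_zero g_range_add g_range_Suc g_funpow_hom)

end

locale p_power_frobenius_extension = frobenius_extension +
  fixes e :: nat
  assumes r_eq: "r = p ^ e"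
begin

lemma prime_CHAR: "prime CHAR('a)" and r_eq_CHAR: "r = CHAR('a) ^ e"
  by (simp_all add: CHAR_eq prime_p r_eq)

lemma difference_funpow_pred_r: "(difference g ^^ (r - 1)) x = rel_trace x"
  unfolding rel_trace_def
  using g_additive prime_CHAR r_eq_CHAR by (rule difference_funpow_pred_prime_power_CHAR)

lemma difference_funpow_r: "(difference g ^^ r) x = 0"
  using difference_funpow_prime_power_CHAR[OF g_additive prime_CHAR r_eq_CHAR] by (simp add: g_funpow_r)

lemma difference_range_r: "difference_range g r = {0}"
  by (auto simp: difference_range_def difference_funpow_r)

end

locale E_frobenius_subgroup = p_power_frobenius_extension +
  fixes H :: "'a semilin set"
  assumes subgroup_H: "subgroup H GammaL4" and H_subset: "H \<subseteq> E_frobenius"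
begin

abbreviation G :: "'a semilin monoid" where
  "G \<equiv> GammaL4\<lparr>carrier := H\<rparr>"

sublocale G: group G
  using subgroup_H by (rule GammaL4.subgroup_imp_group)

lemma lower_central_series_add_subset_filtration:
  assumes N: "E_central_filtration N" and start: "lower_central_series G n \<subseteq> N 0"
  shows "lower_central_series G (n + k) \<subseteq> N k"
proof -
  have "lower_central_series G (n + k) \<subseteq> N k \<inter> H"
  proof (rule G.lower_central_series_add_subset)
    show "subgroup (N k \<inter> H) G" for k
    proof (rule G.finite_subgroupI)
      show "N k \<inter> H \<noteq> {}"
        using N subgroup.one_closed[OF subgroup_H] unfolding E_central_filtration_def by blast
    qed (use N subgroup.m_closed[OF subgroup_H] in \<open>simp_all add: E_central_filtration_def\<close>)
    show "lower_central_series G n \<subseteq> N 0 \<inter> H"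
      using start subgroup.subset[OF G.subgroup_lower_central_series] by simp
    show "y \<in> N (Suc k) \<inter> H" if "x \<in> N k \<inter> H" "h \<in> carrier G" "y \<in> carrier G"
      "h \<otimes>\<^bsub>G\<^esub> x \<otimes>\<^bsub>G\<^esub> y = x \<otimes>\<^bsub>G\<^esub> h" for k x h y
    proof -
      have "x \<in> N k" "h \<in> E_frobenius" "y \<in> carrier GammaL4" "y \<in> H"
        "h \<otimes>\<^bsub>GammaL4\<^esub> x \<otimes>\<^bsub>GammaL4\<^esub> y = x \<otimes>\<^bsub>GammaL4\<^esub> h"
        using that H_subset subgroup.subset[OF subgroup_H] by auto
      then show ?thesis
        using N unfolding E_central_filtration_def by blast
    qed
  qed
  then show ?thesis by blast
qed

lemma lower_central_series_3r: "lower_central_series G (3 * r) = {\<one>\<^bsub>G\<^esub>}"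
proof -
  have "lower_central_series G 0 \<subseteq> ct_layer 0"
    using H_subset by (simp add: E_frobenius_eq_ct_layer)
  with E_central_filtration_ct_layer have "lower_central_series G (0 + r) \<subseteq> ct_layer r"
    by (rule lower_central_series_add_subset_filtration)
  also have "ct_layer r \<subseteq> ab_layer UNIV (difference_range g 0)"
    using r_pos by (auto simp: ct_layer_def ab_layer_def difference_range_r difference_range_0 E_ab_def id_def)
  finally have "lower_central_series G (0 + r + r) \<subseteq> ab_layer UNIV (difference_range g r)"
    by (rule lower_central_series_add_subset_filtration[OF E_central_filtration_b_layer])
  also have "ab_layer UNIV (difference_range g r) = ab_layer (difference_range g 0) {0}"
    by (simp add: difference_range_r difference_range_0)
  finally have "lower_central_series G (0 + r + r + r) \<subseteq> ab_layer (difference_range g r) {0}"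
    by (intro lower_central_series_add_subset_filtration[OF E_central_filtration_a_layer]) simp
  also have "ab_layer (difference_range g r) {0} = {\<one>\<^bsub>G\<^esub>}"
    by (simp add: ab_layer_def difference_range_r GammaL4_one_eq_E_ab)
  also have "0 + r + r + r = 3 * r"
    by simp
  finally have "lower_central_series G (3 * r) \<subseteq> {\<one>\<^bsub>G\<^esub>}" .
  then show ?thesis
    using subgroup.one_closed[OF G.subgroup_lower_central_series, of "3 * r"] by blast
qed

lemma commutator_in_lower_central_series_Suc:
  assumes x: "x \<in> lower_central_series G n" and "h \<in> H" and y: "y \<in> carrier GammaL4"
    and eq: "h \<otimes>\<^bsub>GammaL4\<^esub> x \<otimes>\<^bsub>GammaL4\<^esub> y = x \<otimes>\<^bsub>GammaL4\<^esub> h"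
  shows "y \<in> lower_central_series G (Suc n)"
proof -
  have "x \<in> H"
    using x subgroup.subset[OF G.subgroup_lower_central_series] by auto
  with subgroup_H have "y \<in> H"
    using \<open>h \<in> H\<close> y eq by (rule GammaL4.commutator_in_subgroup)
  then show ?thesis
    using \<open>h \<in> H\<close> eq by (intro G.lower_central_series_SucI[OF x]) simp_all
qed

context
  fixes a\<^sub>0 b\<^sub>0 c\<^sub>0 t\<^sub>0
  assumes h: "(E_mat a\<^sub>0 b\<^sub>0 c\<^sub>0 t\<^sub>0, g) \<in> H"
begin

lemma lower_central_series_Suc_E_ab:
  assumes "E_ab a b \<in> lower_central_series G n"
  shows "E_ab (difference g a - 2 * c\<^sub>0 * g b) (difference g b) \<in> lower_central_series G (Suc n)"
  unfolding difference_def
  using assms h E_ab_in_carrier_GammaL4 commutator_E_ab[OF g_in_field_auts]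
  by (rule commutator_in_lower_central_series_Suc)

lemma ex_E_ab_difference_funpow_in_lower_central_series:
  assumes "E_ab a b \<in> H"
  shows "\<exists>a'. E_ab a' ((difference g ^^ n) b) \<in> lower_central_series G n"
proof (induction n)
  case 0
  show ?case
    by (rule exI[of _ a]) (use assms in simp)
next
  case (Suc n)
  then obtain a' where "E_ab a' ((difference g ^^ n) b) \<in> lower_central_series G n" ..
  from lower_central_series_Suc_E_ab[OF this] show ?case
    unfolding funpow.simps(2) o_apply by (rule exI)
qed

lemma E_ab_difference_funpow_in_lower_central_series:
  assumes "E_ab a 0 \<in> lower_central_series G n"
  shows "E_ab ((difference g ^^ k) a) 0 \<in> lower_central_series G (n + k)"
proof (induction k)
  case (Suc k)
  from lower_central_series_Suc_E_ab[OF this] show ?case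
    by (simp add: difference_def[of g 0] g_hom del: lower_central_series.simps)
qed (use assms in simp)

lemma rel_trace_mult_in_lower_central_series:
  assumes "E_ab a b \<in> H"
  shows "E_ab (- 2 * rel_trace c\<^sub>0 * rel_trace b) 0 \<in> lower_central_series G (2 * r - 1)"
proof -
  have r: "Suc (r - 1) = r"
    using r_pos by simp
  obtain a' where "E_ab a' (rel_trace b) \<in> lower_central_series G (r - 1)"
    using ex_E_ab_difference_funpow_in_lower_central_series[OF assms] difference_funpow_pred_r by metis
  then have "E_ab (difference g a' - 2 * c\<^sub>0 * rel_trace b) 0 \<in> lower_central_series G r"
    using lower_central_series_Suc_E_ab[of a' "rel_trace b" "r - 1"]
    by (simp only: r g_rel_trace difference_def[of g "rel_trace b"] diff_self)
  then have "E_ab (rel_trace (difference g a' - 2 * c\<^sub>0 * rel_trace b)) 0 \<in>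
      lower_central_series G (r + (r - 1))"
    using E_ab_difference_funpow_in_lower_central_series difference_funpow_pred_r by metis
  moreover have "rel_trace (difference g a' - 2 * c\<^sub>0 * rel_trace b) = - 2 * rel_trace c\<^sub>0 * rel_trace b"
  proof -
    have "rel_trace (difference g a') = (difference g ^^ Suc (r - 1)) a'"
      by (simp only: funpow_Suc_right o_apply difference_funpow_pred_r)
    moreover have "rel_trace (2 * rel_trace b * c\<^sub>0) = 2 * rel_trace b * rel_trace c\<^sub>0"
      by (intro rel_trace_scale) (simp add: g_hom field_auts_numeral[OF g_in_field_auts] g_rel_trace)
    ultimately show ?thesis
      by (simp only: r difference_funpow_r rel_trace_diff) (simp add: mult_ac)
  qed
  moreover have "r + (r - 1) = 2 * r - 1"
    using r_pos by simp
  ultimately show ?thesis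
    by (simp only:)
qed

lemma nilpotency_class_bounds:
  assumes "odd p" "l > 1" and \<mu>: "\<mu> \<noteq> 0" "g \<mu> = \<mu>"
    and ker: "\<And>b. tr (\<mu> * b) = 0 \<Longrightarrow> E_ab 0 b \<in> H" and "rel_trace c\<^sub>0 \<noteq> 0"
  shows "nilpotent_group G \<and> nilpotency_class G \<in> {2 * r..3 * r}"
proof -
  obtain b where b: "tr (\<mu> * b) = 0" "rel_trace b \<noteq> 0"
    using \<open>l > 1\<close> \<mu> by (rule ex_tr_eq_0_rel_trace_neq_0)
  have "- 2 * rel_trace c\<^sub>0 * rel_trace b \<noteq> 0"
    using b(2) \<open>rel_trace c\<^sub>0 \<noteq> 0\<close> two_neq_0[OF \<open>odd p\<close>] by simp
  then have "lower_central_series G (2 * r - 1) \<noteq> {\<one>\<^bsub>G\<^esub>}"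
    using rel_trace_mult_in_lower_central_series[OF ker[OF b(1)]]
    by (auto simp: GammaL4_one_eq_E_ab E_ab_eq_iff)
  from G.nilpotency_class_between[OF lower_central_series_3r this] show ?thesis
    using r_pos by simp
qed

end

end

section \<open>The three constructions\<close>

lemma prime_field_pow_of_nat:
  assumes "f ^^ CHAR('a::field) = id"
  shows "prime_field_pow f (of_nat k :: 'a) = f ^^ k"
proof -
  define k' where "k' = (LEAST i. of_nat i = (of_nat k :: 'a))"
  have "of_nat k' = (of_nat k :: 'a)"
    unfolding k'_def by (rule LeastI) (rule refl)
  then have "k' mod CHAR('a) = k mod CHAR('a)"
    by (simp add: of_nat_eq_iff_cong_CHAR cong_def)
  moreover have "(f ^^ (i mod CHAR('a))) x = (f ^^ i) x" for i x
    using assms by (intro funpow_mod_eq) simp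
  ultimately have "f ^^ k' = f ^^ k"
    by (metis ext)
  then show ?thesis
    by (simp add: prime_field_pow_def k'_def)
qed

lemma prime_field_pow_0: "prime_field_pow f 0 = id"
  by (simp add: prime_field_pow_def Least_equality id_def)

lemma poly_lin_poly: "poly (lin_poly p n s) x = (\<Sum>i<n. s i * x ^ (p ^ i))"
  by (simp add: lin_poly_def poly_sum poly_monom)

lemma coeff_lin_poly:
  assumes "p > 1" "i < n"
  shows "Polynomial.coeff (lin_poly p n s) (p ^ i) = s i"
  using assms by (simp add: lin_poly_def coeff_sum coeff_monom)

context frobenius_extension
begin

lemma in_subfield_iff: "x \<in> subfield_of_order (p ^ l) \<longleftrightarrow> g x = x"
  by (simp add: subfield_of_order_def g_eq)

lemma lin_poly_additive: "Modules.additive (poly (lin_poly p n s) :: 'a \<Rightarrow> 'a)"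
  by (rule additive.intro) (simp add: poly_lin_poly frobenius_hom distrib_left sum.distrib)

lemma lin_poly_g:
  assumes "\<And>i. i < n \<Longrightarrow> g (s i) = s i"
  shows "poly (lin_poly p n s) (g x) = g (poly (lin_poly p n s) x)"
proof -
  have "g (x ^ (p ^ i)) = g x ^ (p ^ i)" for i
    by (simp add: g_eq mult.commute flip: power_mult)
  then show ?thesis
    by (simp add: poly_lin_poly field_auts_sum[OF g_in_field_auts] g_hom assms)
qed

lemma tr_mult_power_eq:
  assumes "i \<le> r * l"
  shows "tr (x * y ^ (p ^ i)) = tr (x ^ (p ^ (r * l - i)) * y)"
proof -
  have "tr (x * y ^ (p ^ i)) = tr ((x * y ^ (p ^ i)) ^ (p ^ (r * l - i)))"
    by (rule tr_frobenius[symmetric])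
  also have "(x * y ^ (p ^ i)) ^ (p ^ (r * l - i)) = x ^ (p ^ (r * l - i)) * y ^ (p ^ (r * l))"
    using assms by (simp add: power_mult_distrib flip: power_mult power_add)
  also have "y ^ (p ^ (r * l)) = y"
    using finite_field_power_card[of y] by (simp add: card_eq)
  finally show ?thesis .
qed

lemma tr_lin_poly_symmetric:
  assumes s: "\<And>i. i \<in> {1..r * l - 1} \<Longrightarrow> \<mu> * s i = s (r * l - i) ^ (p ^ i) * \<mu> ^ (p ^ i)"
  shows "tr (\<mu> * x * poly (lin_poly p (r * l) s) y) = tr (\<mu> * y * poly (lin_poly p (r * l) s) x)"
proof -
  let ?n = "r * l"
  have expand: "tr (\<mu> * x * poly (lin_poly p ?n s) y) =
      tr (\<mu> * s 0 * x * y) + (\<Sum>i\<in>{1..?n - 1}. tr (\<mu> * s i * x * y ^ (p ^ i)))" for x y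
  proof -
    have "{..<?n} = insert 0 {1..?n - 1}"
      using r_pos l_pos by auto
    then have "\<mu> * x * poly (lin_poly p ?n s) y =
        \<mu> * s 0 * x * y + (\<Sum>i\<in>{1..?n - 1}. \<mu> * s i * x * y ^ (p ^ i))"
      by (simp add: poly_lin_poly sum_distrib_left distrib_left mult_ac)
    then show ?thesis
      by (simp only: tr_hom tr_sum)
  qed
  have "tr (\<mu> * s i * x * y ^ (p ^ i)) = tr (\<mu> * s (?n - i) * y * x ^ (p ^ (?n - i)))"
    if i: "i \<in> {1..?n - 1}" for i
  proof -
    have "?n - i \<in> {1..?n - 1}" "?n - (?n - i) = i" "i \<le> ?n"
      using i by auto
    then have "s i ^ (p ^ (?n - i)) * \<mu> ^ (p ^ (?n - i)) = \<mu> * s (?n - i)"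
      using s[of "?n - i"] by simp
    then have "(\<mu> * s i * x) ^ (p ^ (?n - i)) * y = \<mu> * s (?n - i) * y * x ^ (p ^ (?n - i))"
      by (simp add: power_mult_distrib mult_ac)
    then show ?thesis
      unfolding tr_mult_power_eq[OF \<open>i \<le> ?n\<close>] by (rule arg_cong)
  qed
  then have "(\<Sum>i\<in>{1..?n - 1}. tr (\<mu> * s i * x * y ^ (p ^ i))) =
    (\<Sum>i\<in>{1..?n - 1}. tr (\<mu> * s i * y * x ^ (p ^ i)))"
    by (intro sum.reindex_bij_witness[of _ "\<lambda>i. ?n - i" "\<lambda>i. ?n - i"]) auto
  moreover have "\<mu> * s 0 * x * y = \<mu> * s 0 * y * x"
    by (simp add: mult_ac)
  ultimately show ?thesis
    unfolding expand by (simp only:)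
qed

lemma prime_field_pow_add:
  assumes "g ^^ p = id" "x ^ p = x" "y ^ p = y"
  shows "prime_field_pow g (x + y) = prime_field_pow g y \<circ> prime_field_pow g x"
proof -
  obtain i j where "x = of_nat i" "y = of_nat j"
    using assms(2,3) by (metis prime_field_eq_of_nat)
  moreover from this have "x + y = of_nat (j + i)"
    by (simp add: add.commute)
  ultimately show ?thesis
    using assms(1) by (simp only: prime_field_pow_of_nat CHAR_eq funpow_add)
qed

lemma E_mat_prime_field_pow_in_E_frobenius: "(E_mat a b c t, prime_field_pow (g ^^ k) x) \<in> E_frobenius"
  unfolding E_frobenius_def prime_field_pow_def funpow_mult by blast

definition semilin_graph :: "('a \<Rightarrow> 'a) \<Rightarrow> ('a \<Rightarrow> 'a \<Rightarrow> 'a) \<Rightarrow> 'a semilin set" where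
  "semilin_graph S \<theta> = {(E_mat a b c (S c), prime_field_pow g (\<theta> b c)) | a b c. True}"

lemma semilin_graphI: "(E_mat a b c (S c), prime_field_pow g (\<theta> b c)) \<in> semilin_graph S \<theta>"
  unfolding semilin_graph_def by blast

lemma semilin_graph_subset: "semilin_graph S \<theta> \<subseteq> E_frobenius"
  using E_mat_prime_field_pow_in_E_frobenius[of _ _ _ _ 1] by (auto simp: semilin_graph_def)

lemma equivariant_g_funpow:
  assumes "\<And>x. S (g x) = g (S x)"
  shows "S ((g ^^ j) x) = (g ^^ j) (S x)"
  by (induction j) (simp_all add: assms)

lemma subgroup_semilin_graph:
  assumes "g ^^ p = id" and S: "Modules.additive S" "\<And>x. S (g x) = g (S x)"
    and prime_field: "\<And>b c. \<theta> b c ^ p = \<theta> b c"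
    and cocycle: "\<And>b c b' c' j. \<theta> ((g ^^ j) b + b' + (g ^^ j) c * S c') ((g ^^ j) c + c') = \<theta> b c + \<theta> b' c'"
  shows "subgroup (semilin_graph S \<theta>) GammaL4"
proof (rule GammaL4.finite_subgroupI)
  show "semilin_graph S \<theta> \<subseteq> carrier GammaL4"
    using semilin_graph_subset E_frobenius_subset by (rule subset_trans)
  show "semilin_graph S \<theta> \<noteq> {}"
    using semilin_graphI by blast
  fix x y assume "x \<in> semilin_graph S \<theta>" "y \<in> semilin_graph S \<theta>"
  then obtain a b c a' b' c' where x: "x = (E_mat a b c (S c), prime_field_pow g (\<theta> b c))"
    and y: "y = (E_mat a' b' c' (S c'), prime_field_pow g (\<theta> b' c'))"
    unfolding semilin_graph_def by blast
  obtain j where j: "prime_field_pow g (\<theta> b' c') = g ^^ j"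
    by (simp add: prime_field_pow_def)
  have "S ((g ^^ j) c + c') = (g ^^ j) (S c) + S c'"
    by (simp add: additive.add[OF S(1)] equivariant_g_funpow[of S, OF S(2)])
  moreover have "prime_field_pow g (\<theta> ((g ^^ j) b + b' + (g ^^ j) c * S c') ((g ^^ j) c + c')) =
      g ^^ j \<circ> prime_field_pow g (\<theta> b c)"
    unfolding cocycle prime_field_pow_add[OF assms(1) prime_field prime_field] j ..
  ultimately show "x \<otimes>\<^bsub>GammaL4\<^esub> y \<in> semilin_graph S \<theta>"
    unfolding x y j GammaL4_mult_E_mat[OF g_funpow_in_field_auts] by (metis semilin_graphI)
qed simp

definition quadratic_trace :: "'a \<Rightarrow> ('a \<Rightarrow> 'a) \<Rightarrow> 'a \<Rightarrow> 'a \<Rightarrow> 'a" where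
  "quadratic_trace \<mu> S b c = 1 / 2 * - tr (\<mu> * c * S c) + tr (\<mu> * b)"

lemma quadratic_trace_in_prime_field: "quadratic_trace \<mu> S b c ^ p = quadratic_trace \<mu> S b c"
proof -
  have "(2 :: 'a) ^ p = 2"
    using frobenius_hom(1)[of 1 1 1] by simp
  then show ?thesis
    using frobenius_hom(4)[of _ _ 1]
    by (simp add: quadratic_trace_def power_divide tr_in_prime_field)
qed

lemma quadratic_trace_cocycle:
  assumes "odd p" "g \<mu> = \<mu>" and S: "Modules.additive S" "\<And>x. S (g x) = g (S x)"
    and symmetric: "\<And>x y. tr (\<mu> * x * S y) = tr (\<mu> * y * S x)"
  shows "quadratic_trace \<mu> S ((g ^^ j) b + b' + (g ^^ j) c * S c') ((g ^^ j) c + c') =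
    quadratic_trace \<mu> S b c + quadratic_trace \<mu> S b' c'"
proof -
  define d where "d = (g ^^ j) c"
  have "tr (\<mu> * (d + c') * S (d + c')) =
      tr (\<mu> * d * S d) + tr (\<mu> * c' * S c') + 2 * tr (\<mu> * d * S c')"
    using symmetric[of c' d] by (simp add: additive.add[OF S(1)] distrib_left distrib_right tr_hom)
  moreover have "tr (\<mu> * d * S d) = tr (\<mu> * c * S c)"
    using tr_mult_g_funpow[OF assms(2), of j "c * S c"]
    by (simp add: d_def equivariant_g_funpow[of S, OF S(2)] g_funpow_hom mult.assoc)
  moreover have "tr (\<mu> * ((g ^^ j) b + b' + d * S c')) = tr (\<mu> * b) + tr (\<mu> * b') + tr (\<mu> * d * S c')"
    by (simp add: distrib_left tr_hom tr_mult_g_funpow[OF assms(2)] mult.assoc)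
  moreover have "1 / 2 * - (u + v + 2 * w) + (x + y + w) = 1 / 2 * - u + x + (1 / 2 * - v + y)"
    for u v w x y :: 'a
    using two_neq_0[OF assms(1)] by (simp add: add_divide_distrib diff_divide_distrib)
  ultimately show ?thesis
    unfolding quadratic_trace_def d_def[symmetric] by (simp only:)
qed

end

lemma (in p_power_frobenius_extension) nilpotency_class_semilin_graph:
  assumes "odd p" "l > 1" and "r = p" and S: "Modules.additive S" "\<And>x. S (g x) = g (S x)"
    and prime_field: "\<And>b c. \<theta> b c ^ p = \<theta> b c"
    and cocycle: "\<And>b c b' c' j. \<theta> ((g ^^ j) b + b' + (g ^^ j) c * S c') ((g ^^ j) c + c') = \<theta> b c + \<theta> b' c'"
    and \<mu>: "\<mu> \<noteq> 0" "g \<mu> = \<mu>" and ker: "\<And>b. tr (\<mu> * b) = 0 \<Longrightarrow> \<theta> b 0 = 0"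
    and g: "\<theta> b\<^sub>0 c\<^sub>0 = 1" "rel_trace c\<^sub>0 \<noteq> 0"
  shows "nilpotent_group (GammaL4\<lparr>carrier := semilin_graph S \<theta>\<rparr>) \<and>
    nilpotency_class (GammaL4\<lparr>carrier := semilin_graph S \<theta>\<rparr>) \<in> {2 * r..3 * r}"
proof -
  have order: "g ^^ p = id"
    using g_funpow_r \<open>r = p\<close> by simp
  interpret E_frobenius_subgroup p r l g e "semilin_graph S \<theta>"
    using subgroup_semilin_graph[OF order S prime_field cocycle] semilin_graph_subset
    by (intro E_frobenius_subgroup.intro E_frobenius_subgroup_axioms.intro
        p_power_frobenius_extension_axioms)
  have "prime_field_pow g (1 :: 'a) = g"
    using prime_field_pow_of_nat[of g 1] order by (simp add: CHAR_eq)
  then have "(E_mat 0 b\<^sub>0 c\<^sub>0 (S c\<^sub>0), g) \<in> semilin_graph S \<theta>"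
    using semilin_graphI[of 0 b\<^sub>0 c\<^sub>0 S \<theta>] by (simp add: g(1))
  moreover have "E_ab 0 b \<in> semilin_graph S \<theta>" if "tr (\<mu> * b) = 0" for b
    using semilin_graphI[of 0 b 0 S \<theta>]
    by (simp add: E_ab_def additive.zero[OF S(1)] ker[OF that] prime_field_pow_0)
  ultimately show ?thesis
    using assms(1,2) \<mu> g(2) by (intro nilpotency_class_bounds)
qed

lemma (in p_power_frobenius_extension) nilpotency_class_generate:
  assumes "odd p" "l > 1" and X: "X \<subseteq> E_frobenius"
    and \<mu>: "\<mu> \<noteq> 0" "g \<mu> = \<mu>" and ker: "\<And>b. tr (\<mu> * b) = 0 \<Longrightarrow> E_ab 0 b \<in> X"
    and g: "(E_mat a\<^sub>0 b\<^sub>0 c\<^sub>0 t\<^sub>0, g) \<in> X" "rel_trace c\<^sub>0 \<noteq> 0"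
  shows "nilpotent_group (GammaL4\<lparr>carrier := generate GammaL4 X\<rparr>) \<and>
    nilpotency_class (GammaL4\<lparr>carrier := generate GammaL4 X\<rparr>) \<in> {2 * r..3 * r}"
proof -
  have "subgroup (generate GammaL4 X) GammaL4"
    using X E_frobenius_subset by (intro GammaL4.generate_is_subgroup) blast
  then interpret E_frobenius_subgroup p r l g e "generate GammaL4 X"
    using GammaL4.generate_subgroup_incl[OF X subgroup_E_frobenius]
    by (intro E_frobenius_subgroup.intro E_frobenius_subgroup_axioms.intro
        p_power_frobenius_extension_axioms)
  show ?thesis
    using generate.incl[OF g(1)] assms(1,2) \<mu> generate.incl[OF ker] g(2) by (rule nilpotency_class_bounds)
qed

lemma construction_B_nilpotency_class:
  fixes g :: "'a::{field,finite} \<Rightarrow> 'a"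
  assumes "construction_B p l g G" "l > 1"
  shows "nilpotent_group G \<and>
    nilpotency_class G \<in> {2 * group.ord Aut_field g..3 * group.ord Aut_field g}"
proof -
  obtain s \<mu> where p: "prime p" "odd p" and card: "CARD('a) = p ^ (p * l)"
    and g: "g = (\<lambda>x. x ^ (p ^ l))"
    and s: "\<And>i. Polynomial.coeff (lin_poly p (p * l) s) i \<in> subfield_of_order (p ^ l)"
    and \<mu>: "\<mu> \<in> subfield_of_order (p ^ l) - {0}"
    and G: "G = GammaL4\<lparr>carrier := {(E_mat a b c (poly (lin_poly p (p * l) s) c),
      prime_field_pow g (abs_trace p (p * l) (\<mu> * c))) | a b c. True}\<rparr>"
    using assms(1) unfolding construction_B_def reduced_linearized_def by auto
  interpret p_power_frobenius_extension p p l g 1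
    using p card g by unfold_locales auto
  have g_\<mu>: "\<mu> \<noteq> 0" "g \<mu> = \<mu>"
    using \<mu> by (simp_all add: in_subfield_iff)
  have g_s: "g (s i) = s i" if "i < p * l" for i
    using s[of "p ^ i"] coeff_lin_poly[OF p_gt_1 that, of s] by (simp add: in_subfield_iff)
  obtain c\<^sub>0 where c\<^sub>0: "tr (\<mu> * c\<^sub>0) = 1"
    using tr_mult_surj[OF g_\<mu>(1), of 1] by auto
  have graph: "G = GammaL4\<lparr>carrier := semilin_graph (poly (lin_poly p (p * l) s)) (\<lambda>b c. tr (\<mu> * c))\<rparr>"
    by (simp add: G semilin_graph_def)
  have "tr (\<mu> * ((g ^^ j) c + c')) = tr (\<mu> * c) + tr (\<mu> * c')" for j c c'
    by (simp add: distrib_left tr_hom tr_mult_g_funpow[OF g_\<mu>(2)])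
  moreover have "rel_trace c\<^sub>0 \<noteq> 0"
    using g_\<mu>(2) by (rule rel_trace_neq_0I) (simp add: c\<^sub>0)
  ultimately show ?thesis
    unfolding ord_g graph using p(2) assms(2) g_\<mu> c\<^sub>0
    by (intro nilpotency_class_semilin_graph[where \<mu> = \<mu> and c\<^sub>0 = c\<^sub>0 and b\<^sub>0 = 0])
      (simp_all add: lin_poly_additive lin_poly_g g_s tr_in_prime_field tr_hom)
qed

lemma construction_C_nilpotency_class:
  fixes g :: "'a::{field,finite} \<Rightarrow> 'a"
  assumes "construction_C p l g G" "l > 1"
  shows "nilpotent_group G \<and>
    nilpotency_class G \<in> {2 * group.ord Aut_field g..3 * group.ord Aut_field g}"
proof -
  obtain \<mu> s where p: "prime p" "odd p" and card: "CARD('a) = p ^ (p * l)"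
    and g: "g = (\<lambda>x. x ^ (p ^ l))"
    and \<mu>: "\<mu> \<in> subfield_of_order (p ^ l) - {0}"
    and s: "\<And>i. i < p * l \<Longrightarrow> s i \<in> subfield_of_order (p ^ l)"
    and symmetric: "\<And>i. i \<in> {1..p * l - 1} \<Longrightarrow> \<mu> * s i - s (p * l - i) ^ (p ^ i) * \<mu> ^ (p ^ i) = 0"
    and G: "G = GammaL4\<lparr>carrier := {(E_mat a b c (poly (lin_poly p (p * l) s) c),
      prime_field_pow g (1 / 2 * - abs_trace p (p * l) (\<mu> * c * poly (lin_poly p (p * l) s) c) +
        abs_trace p (p * l) (\<mu> * b))) | a b c. True}\<rparr>"
    using assms(1) unfolding construction_C_def by blast
  interpret p_power_frobenius_extension p p l g 1
    using p card g by unfold_locales auto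
  define S where "S = poly (lin_poly p (p * l) s)"
  have g_\<mu>: "\<mu> \<noteq> 0" "g \<mu> = \<mu>"
    using \<mu> by (simp_all add: in_subfield_iff)
  have S: "Modules.additive S" "S (g x) = g (S x)" for x
    unfolding S_def using s by (simp_all add: lin_poly_additive lin_poly_g in_subfield_iff)
  have "tr (\<mu> * x * S y) = tr (\<mu> * y * S x)" for x y
    unfolding S_def using symmetric by (intro tr_lin_poly_symmetric) simp
  note cocycle = quadratic_trace_cocycle[OF p(2) g_\<mu>(2) S this]
  have graph: "G = GammaL4\<lparr>carrier := semilin_graph S (quadratic_trace \<mu> S)\<rparr>"
    by (simp add: G semilin_graph_def quadratic_trace_def S_def)
  obtain c\<^sub>0 where c\<^sub>0: "rel_trace c\<^sub>0 \<noteq> 0"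
    using ex_tr_eq_0_rel_trace_neq_0[OF assms(2) g_\<mu>] by blast
  have "(1 - quadratic_trace \<mu> S 0 c\<^sub>0) ^ p = 1 - quadratic_trace \<mu> S 0 c\<^sub>0"
    using frobenius_hom(4)[of 1 _ 1] by (simp add: quadratic_trace_in_prime_field)
  then obtain b\<^sub>0 where "tr (\<mu> * b\<^sub>0) = 1 - quadratic_trace \<mu> S 0 c\<^sub>0"
    using tr_mult_surj[OF g_\<mu>(1)] by blast
  then have "quadratic_trace \<mu> S b\<^sub>0 c\<^sub>0 = 1"
    by (simp add: quadratic_trace_def tr_hom)
  moreover have "quadratic_trace \<mu> S b 0 = 0" if "tr (\<mu> * b) = 0" for b
    using that by (simp add: quadratic_trace_def tr_hom)
  ultimately show ?thesis
    unfolding ord_g graph using p(2) assms(2) S quadratic_trace_in_prime_field cocycle g_\<mu> c\<^sub>0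
    by (intro nilpotency_class_semilin_graph[where \<mu> = \<mu> and b\<^sub>0 = b\<^sub>0 and c\<^sub>0 = c\<^sub>0]) simp_all
qed

lemma construction_D_nilpotency_class:
  fixes g :: "'a::{field,finite} \<Rightarrow> 'a"
  assumes "construction_D l g G" "l > 1"
  shows "nilpotent_group G \<and>
    nilpotency_class G \<in> {2 * group.ord Aut_field g..3 * group.ord Aut_field g}"
proof -
  obtain \<mu>\<^sub>C t\<^sub>C \<mu>\<^sub>B s \<alpha> where card: "CARD('a) = 3 ^ (9 * l)" and g: "g = (\<lambda>x. x ^ (3 ^ l))"
    and \<mu>\<^sub>C: "\<mu>\<^sub>C \<in> subfield_of_order (3 ^ l) - {0}" and t\<^sub>C: "abs_trace 3 (9 * l) (\<mu>\<^sub>C * t\<^sub>C) \<noteq> 0"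
    and \<mu>\<^sub>B: "\<mu>\<^sub>B \<in> subfield_of_order (3 ^ l) - {0}"
    and G: "G = GammaL4\<lparr>carrier := generate GammaL4
      ({(E_mat a b c (poly (lin_poly 3 (9 * l) s) c),
         prime_field_pow (g ^^ 3) (1 / 2 * - abs_trace 3 (9 * l) (\<mu>\<^sub>B * c * poly (lin_poly 3 (9 * l) s) c) +
           abs_trace 3 (9 * l) (\<alpha> * c + \<mu>\<^sub>B * b))) | a b c. c \<in> {z. abs_trace 3 (9 * l) (\<mu>\<^sub>C * z) = 0}}
       \<union> {(E_mat 0 0 t\<^sub>C (poly (lin_poly 3 (9 * l) s) t\<^sub>C), g)})\<rparr>"
    using assms(1) unfolding construction_D_def by blast
  interpret p_power_frobenius_extension 3 9 l g 2
    using card g by unfold_locales auto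
  define S where "S = poly (lin_poly 3 (9 * l) s)"
  define \<theta> where "\<theta> b c = 1 / 2 * - tr (\<mu>\<^sub>B * c * S c) + tr (\<alpha> * c + \<mu>\<^sub>B * b)" for b c
  define X where "X = {(E_mat a b c (S c), prime_field_pow (g ^^ 3) (\<theta> b c)) | a b c. tr (\<mu>\<^sub>C * c) = 0} \<union>
    {(E_mat 0 0 t\<^sub>C (S t\<^sub>C), g ^^ 1)}"
  have G_X: "G = GammaL4\<lparr>carrier := generate GammaL4 X\<rparr>"
    by (simp add: G X_def \<theta>_def S_def)
  have "(E_mat 0 0 t\<^sub>C (S t\<^sub>C), g ^^ 1) \<in> E_frobenius"
    unfolding E_frobenius_def by blast
  then have "X \<subseteq> E_frobenius"
    unfolding X_def using E_mat_prime_field_pow_in_E_frobenius by blast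
  moreover have "E_ab 0 b \<in> X" if "tr (\<mu>\<^sub>B * b) = 0" for b
  proof -
    have "tr (\<mu>\<^sub>C * 0) = 0"
      by (simp add: tr_hom)
    then have "(E_mat 0 b 0 (S 0), prime_field_pow (g ^^ 3) (\<theta> b 0)) \<in> X"
      unfolding X_def by blast
    then show ?thesis
      using that additive.zero[OF lin_poly_additive]
      by (simp add: \<theta>_def S_def E_ab_def tr_hom prime_field_pow_0)
  qed
  moreover have "(E_mat 0 0 t\<^sub>C (S t\<^sub>C), g) \<in> X"
    by (simp add: X_def)
  moreover have "rel_trace t\<^sub>C \<noteq> 0"
    using \<mu>\<^sub>C t\<^sub>C by (intro rel_trace_neq_0I[of \<mu>\<^sub>C]) (simp_all add: in_subfield_iff)
  ultimately show ?thesis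
    unfolding G_X ord_g using \<mu>\<^sub>B assms(2)
    by (intro nilpotency_class_generate[where \<mu> = \<mu>\<^sub>B]) (simp_all add: in_subfield_iff)
qed

theorem theorem8p8:
  fixes g :: "'a::{field,finite} \<Rightarrow> 'a"
    and G :: "'a semilin monoid"
    and p e l :: nat
  assumes "construction_B p l g G \<or> construction_C p l g G \<or> (p = 3 \<and> construction_D l g G)"
    and "p ^ e = group.ord Aut_field g"
    and "l > 1"
  shows "nilpotent_group G \<and> nilpotency_class G \<in> {2 * p ^ e..3 * p ^ e}"
  unfolding assms(2) using assms(1,3)
    construction_B_nilpotency_class construction_C_nilpotency_class construction_D_nilpotency_class
  by blast

end
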